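(* Let $1\le d_f<\infty$, $2\le d_w<\infty$ with $d_f<d_w$. Let $\{(G^{(N)},\mu^{(N)})\}_{N\ge 1}$ be finite weighted graphs with $\sharp V(G^{(N)})\to\infty$ which satisfy the uniform weight conditions with exponent $d_f$ and the uniform parabolic Harnack inequality $\mathrm{UPHI}(d_w)$. Put $T_N=(\mathrm{diam}\{G^{(N)}\})^{d_w}$. Then there is a finite constant $c_0$ such that for all integers $t\ge0$ and all $N\ge1$, $$\sup_{z\in V(G^{(N)})}P_z\big(\tau_{\rm cov}(G^{(N)})>t\big)\le c_0\,e^{-t/(c_0T_N)}.$$
   Context: Graphs $G=(V(G),E(G))$ are connected, with graph distance $d$, balls $B(x,r)=\{y: d(x,y)\le r\}$, and diameter $\mathrm{diam}\{G\}$. A weighted graph $(G,\mu)$ is a graph with a symmetric function $\mu:V(G)\times V(G)\to[0,\infty)$, $\mu_{xy}=\mu_{yx}$, with $\mu_{xy}>0$ iff $xy\in E(G)$. Put $\mu_x=\sum_{y:xy\in E(G)}\mu_{xy}$, $\mu(A)=\sum_{x\in A}\mu_x$, $V(x,r)=\mu(B(x,r))$. The random walk on $(G,\mu)$ has transition matrix $P(x,y)=\mu_{xy}/\mu_x$; the lazy random walk $\tilde X$ has $\tilde P(x,y)=\frac12P(x,y)$ for $x\ne y$ and $\tilde P(x,x)=\frac12$. A superscript $(N)$ denotes objects on $(G^{(N)},\mu^{(N)})$. $P_z$ is the law of the walk started at $z$. $\sharp A$ is the cardinality of $A$. Uniform weight conditions with exponent $d_f$: there are constants $c_{\rm e},c_{\rm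 v}<\infty$, $p_0>0$ such that for all $N$: (i) $c_{\rm e}^{-1}\le\mu^{(N)}_{xy}\le c_{\rm e}$ for all $xy\in E(G^{(N)})$; (ii) $\mu^{(N)}_{xy}/\mu^{(N)}_x\ge p_0$ for all $xy\in E(G^{(N)})$; (iii) $c_{\rm v}^{-1}r^{d_f}\le V^{(N)}(x,r)\le c_{\rm v}r^{d_f}$ for all $x\in V(G^{(N)})$ and $1\le r\le\mathrm{diam}\{G^{(N)}\}$, and $\mathrm{diam}\{G^{(N)}\}\to\infty$. $\mathrm{UPHI}(d_w)$: there are $C_{\rm PHI}<\infty$ and $c_{\rm PHI}\in(0,1]$, independent of $N$, such that for all $N\ge1$, $x_0\in V(G^{(N)})$, $1\le R\le c_{\rm PHI}\,\mathrm{diam}\{G^{(N)}\}$, and $T\ge2R$ with $T\asymp R^{d_w}$, every nonnegative $u:\{0,1,2,\dots\}\times V(G^{(N)})\to[0,\infty)$ satisfying $u(t+1,x)-u(t,x)=(P^{(N)}-I)u(t,x)$ for all integers $t\in[0,4T]$ and all $x\in B^{(N)}(x_0,2R)$ satisfies $$\max_{z\in B^{(N)}(x_0,R),\,s\in[T,2T]}u(s,z)\le C_{\rm PHI}\min_{z\in B^{(N)}(x_0,R),\,s\in[3T,4T]}\{u(s,z)+u(s+1,z)\}$$ ($s$ integer). Here $T\asymp R^{d_w}$ means $c^{-1}R^{d_w}\le T\le cR^{d_w}$ for a constant $c<\infty$; the inequality is assumed for every such $c$, with $C_{\rm PHI}$ allowed to depend on $c$. The cover time is $\tau_{\rm cov}(G)=\min\{t\ge0:\{\tilde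 X_0,\dots,\tilde X_t\}=V(G)\}$ for the lazy random walk $\tilde X$. *)

theory Defs
  imports "HOL-Probability.Probability"
begin

(* Graphs are given by a vertex set V and a set E of two-element edges; in particular there are
   no loops, which is what makes the lazy transition matrix below stochastic. The weight function
   is extended by 0 to pairs that are not edges, including pairs outside of V. *)

definition edge_rel :: "'a set set \<Rightarrow> ('a \<times> 'a) set" where
  "edge_rel E = {(x, y). {x, y} \<in> E}"

definition finite_weighted_graph ::
    "'a set \<Rightarrow> 'a set set \<Rightarrow> ('a \<Rightarrow> 'a \<Rightarrow> real) \<Rightarrow> bool" where
  "finite_weighted_graph V E \<mu> \<longleftrightarrow>
     finite V \<and> V \<noteq> {} \<and>
     E \<subseteq> {{x, y} | x y. x \<in> V \<and> y \<in> V \<and> x \<noteq> y} \<and>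
     (\<forall>x\<in>V. \<forall>y\<in>V. (x, y) \<in> (edge_rel E)\<^sup>*) \<and>
     (\<forall>x y. 0 \<le> \<mu> x y \<and> \<mu> x y = \<mu> y x \<and> (0 < \<mu> x y \<longleftrightarrow> {x, y} \<in> E))"

definition gdist :: "'a set set \<Rightarrow> 'a \<Rightarrow> 'a \<Rightarrow> nat" where
  "gdist E x y = (LEAST n. (x, y) \<in> edge_rel E ^^ n)"

definition gball :: "'a set \<Rightarrow> 'a set set \<Rightarrow> 'a \<Rightarrow> real \<Rightarrow> 'a set" where
  "gball V E x r = {y \<in> V. real (gdist E x y) \<le> r}"

definition gdiam :: "'a set \<Rightarrow> 'a set set \<Rightarrow> nat" where
  "gdiam V E = Max {gdist E x y | x y. x \<in> V \<and> y \<in> V}"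

definition vertex_weight :: "'a set set \<Rightarrow> ('a \<Rightarrow> 'a \<Rightarrow> real) \<Rightarrow> 'a \<Rightarrow> real" where
  "vertex_weight E \<mu> x = (\<Sum>y | {x, y} \<in> E. \<mu> x y)"

definition ball_volume ::
    "'a set \<Rightarrow> 'a set set \<Rightarrow> ('a \<Rightarrow> 'a \<Rightarrow> real) \<Rightarrow> 'a \<Rightarrow> real \<Rightarrow> real" where
  "ball_volume V E \<mu> x r = (\<Sum>y\<in>gball V E x r. vertex_weight E \<mu> y)"

definition transition :: "'a set set \<Rightarrow> ('a \<Rightarrow> 'a \<Rightarrow> real) \<Rightarrow> 'a \<Rightarrow> 'a \<Rightarrow> real" where
  "transition E \<mu> x y = \<mu> x y / vertex_weight E \<mu> x"

definition lazy_transition :: "'a set set \<Rightarrow> ('a \<Rightarrow> 'a \<Rightarrow> real) \<Rightarrow> 'a \<Rightarrow> 'a \<Rightarrow> real" where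
  "lazy_transition E \<mu> x y = (if x = y then 1 / 2 else transition E \<mu> x y / 2)"

(* embed_pmf is only meaningful if the row of the matrix sums to 1; see pmf_lazy_kernel. *)
definition lazy_kernel :: "'a set set \<Rightarrow> ('a \<Rightarrow> 'a \<Rightarrow> real) \<Rightarrow> 'a \<Rightarrow> 'a pmf" where
  "lazy_kernel E \<mu> x = embed_pmf (lazy_transition E \<mu> x)"

(* Conditional law of the n-th position of a Markov chain given its past, as required by the
   Ionescu-Tulcea construction. *)
definition chain_step :: "('a \<Rightarrow> 'a pmf) \<Rightarrow> 'a \<Rightarrow> nat \<Rightarrow> (nat \<Rightarrow> 'a) \<Rightarrow> 'a measure" where
  "chain_step K z n \<omega> = measure_pmf (case n of 0 \<Rightarrow> return_pmf z | Suc m \<Rightarrow> K (\<omega> m))"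

(* Law, on the space of trajectories, of the Markov chain with kernel K started at z.
   Its finite-dimensional distributions are computed in emeasure_chain_law. *)
definition chain_law :: "('a \<Rightarrow> 'a pmf) \<Rightarrow> 'a \<Rightarrow> (nat \<Rightarrow> 'a) measure" where
  "chain_law K z =
     projective_family.lim UNIV
       (Ionescu_Tulcea.CI (chain_step K z) (\<lambda>_. count_space UNIV)) (\<lambda>_. count_space UNIV)"

definition lazy_walk_law ::
    "'a set set \<Rightarrow> ('a \<Rightarrow> 'a \<Rightarrow> real) \<Rightarrow> 'a \<Rightarrow> (nat \<Rightarrow> 'a) measure" where
  "lazy_walk_law E \<mu> z = chain_law (lazy_kernel E \<mu>) z"

definition cover_time :: "'a set \<Rightarrow> (nat \<Rightarrow> 'a) \<Rightarrow> enat" where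
  "cover_time V \<omega> = Inf {enat t | t. \<omega> ` {0..t} = V}"

definition uniform_weight_conditions ::
    "real \<Rightarrow> (nat \<Rightarrow> 'a set) \<Rightarrow> (nat \<Rightarrow> 'a set set) \<Rightarrow> (nat \<Rightarrow> 'a \<Rightarrow> 'a \<Rightarrow> real) \<Rightarrow> bool" where
  "uniform_weight_conditions d\<^sub>f V E \<mu> \<longleftrightarrow>
     (\<exists>c\<^sub>e c\<^sub>v p\<^sub>0. 0 < c\<^sub>e \<and> 0 < c\<^sub>v \<and> 0 < p\<^sub>0 \<and>
       (\<forall>N\<ge>1.
         (\<forall>x y. {x, y} \<in> E N \<longrightarrow>
            inverse c\<^sub>e \<le> \<mu> N x y \<and> \<mu> N x y \<le> c\<^sub>e \<and>
            p\<^sub>0 \<le> \<mu> N x y / vertex_weight (E N) (\<mu> N) x) \<and>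
         (\<forall>x\<in>V N. \<forall>r::real. 1 \<le> r \<and> r \<le> real (gdiam (V N) (E N)) \<longrightarrow>
            inverse c\<^sub>v * r powr d\<^sub>f \<le> ball_volume (V N) (E N) (\<mu> N) x r \<and>
            ball_volume (V N) (E N) (\<mu> N) x r \<le> c\<^sub>v * r powr d\<^sub>f))) \<and>
     filterlim (\<lambda>N. gdiam (V N) (E N)) at_top sequentially"

definition caloric_on ::
    "'a set \<Rightarrow> 'a set set \<Rightarrow> ('a \<Rightarrow> 'a \<Rightarrow> real) \<Rightarrow> real \<Rightarrow> 'a set \<Rightarrow> (nat \<Rightarrow> 'a \<Rightarrow> real) \<Rightarrow> bool" where
  "caloric_on V E \<mu> S B u \<longleftrightarrow>
     (\<forall>t x. real t \<le> S \<and> x \<in> B \<longrightarrow>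
        u (Suc t) x - u t x = (\<Sum>y\<in>V. transition E \<mu> x y * u t y) - u t x)"

(* The constant c_PHI is chosen before, and C_PHI after, the constant c in the comparison
   of T with R^d_w. Radii and the time scale T are real; times are natural numbers. *)
definition UPHI ::
    "real \<Rightarrow> (nat \<Rightarrow> 'a set) \<Rightarrow> (nat \<Rightarrow> 'a set set) \<Rightarrow> (nat \<Rightarrow> 'a \<Rightarrow> 'a \<Rightarrow> real) \<Rightarrow> bool" where
  "UPHI d\<^sub>w V E \<mu> \<longleftrightarrow>
     (\<exists>c\<^sub>P. 0 < c\<^sub>P \<and> c\<^sub>P \<le> 1 \<and>
       (\<forall>c>0. \<exists>C\<^sub>P::real. \<forall>N\<ge>1. \<forall>x\<^sub>0\<in>V N. \<forall>R T::real.
          1 \<le> R \<and> R \<le> c\<^sub>P * real (gdiam (V N) (E N)) \<and> 2 * R \<le> T \<and>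
          inverse c * R powr d\<^sub>w \<le> T \<and> T \<le> c * R powr d\<^sub>w \<longrightarrow>
          (\<forall>u. (\<forall>t. \<forall>x\<in>V N. 0 \<le> u t x) \<and>
               caloric_on (V N) (E N) (\<mu> N) (4 * T) (gball (V N) (E N) x\<^sub>0 (2 * R)) u \<longrightarrow>
             Max {u s z | s z. z \<in> gball (V N) (E N) x\<^sub>0 R \<and> T \<le> real s \<and> real s \<le> 2 * T}
             \<le> C\<^sub>P * Min {u s z + u (Suc s) z | s z.
                     z \<in> gball (V N) (E N) x\<^sub>0 R \<and> 3 * T \<le> real s \<and> real s \<le> 4 * T})))"

lemma Ionescu_Tulcea_chain_step:
  fixes K :: "'a \<Rightarrow> 'a pmf"
  shows "Ionescu_Tulcea (chain_step K z) (\<lambda>_. count_space UNIV)"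
proof (rule Ionescu_Tulcea.intro)
  fix i :: nat
  show "chain_step K z i
      \<in> measurable (Pi\<^sub>M {0..<i} (\<lambda>_. count_space UNIV)) (subprob_algebra (count_space UNIV))"
  proof (cases i)
    case 0
    then show ?thesis
      by (auto simp: chain_step_def[abs_def] space_subprob_algebra
          intro!: measurable_const measure_pmf.subprob_space_axioms)
  next
    case (Suc m)
    have 1: "(\<lambda>\<omega>. \<omega> m) \<in> measurable (Pi\<^sub>M {0..<i} (\<lambda>_. count_space UNIV)) (count_space UNIV)"
      using Suc by (intro measurable_component_singleton) auto
    have 2: "(\<lambda>x. measure_pmf (K x))
        \<in> measurable (count_space UNIV) (subprob_algebra (count_space UNIV))"
      by (auto simp: space_subprob_algebra intro!: measure_pmf.subprob_space_axioms)
    show ?thesis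
      using measurable_compose[OF 1 2] Suc by (simp add: chain_step_def[abs_def])
  qed
next
  fix i :: nat and x :: "nat \<Rightarrow> 'a"
  show "prob_space (chain_step K z i x)"
    by (simp add: chain_step_def measure_pmf.prob_space_axioms)
qed

lemma
  fixes K :: "'a \<Rightarrow> 'a pmf"
  shows prob_space_chain_law: "prob_space (chain_law K z)"
  and sets_chain_law: "sets (chain_law K z) = sets (Pi\<^sub>M UNIV (\<lambda>_. count_space UNIV))"
  and emeasure_chain_law:
    "emeasure (chain_law K z) {\<omega>. \<forall>i\<le>n. \<omega> i = x i} =
       ennreal (if x 0 = z then \<Prod>i<n. pmf (K (x i)) (x (Suc i)) else 0)"
proof -
  let ?M = "\<lambda>_::nat. count_space (UNIV :: 'a set)"
  interpret IT: Ionescu_Tulcea "chain_step K z" ?M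
    by (rule Ionescu_Tulcea_chain_step)
  have law: "chain_law K z = IT.PF.lim"
    by (simp add: chain_law_def)
  show sets: "sets (chain_law K z) = sets (Pi\<^sub>M UNIV ?M)"
    unfolding law by simp
  let ?x = "\<lambda>n. restrict x {0..<n}"
  have x_space: "?x n \<in> space (Pi\<^sub>M {0..<n} ?M)" for n
    by (auto simp: space_PiM)
  have x_sets: "{?x n} \<in> sets (Pi\<^sub>M {0..<n} ?M)" for n
  proof -
    have "{?x n} = Pi\<^sub>E {0..<n} (\<lambda>i. {x i})"
      by (auto simp: fun_eq_iff restrict_def PiE_iff extensional_def)
    then show ?thesis
      by (simp only:) (intro sets_PiM_I_finite, auto)
  qed
  have undef: "(\<lambda>_. undefined) \<in> space (Pi\<^sub>M {0..<0::nat} ?M)"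
    by (simp add: space_PiM)
  have sets_C: "sets (IT.C 0 n (\<lambda>_. undefined)) = sets (Pi\<^sub>M {0..<n} ?M)" for n
    using IT.sets_C[OF undef, of n] by simp
  have C: "emeasure (IT.C 0 n (\<lambda>_. undefined)) {?x n} =
       (\<Prod>i<n. emeasure (chain_step K z i x) {x i})" for n
  proof (induction n)
    case 0
    show ?case
      using x_sets[of 0] by (simp add: restrict_def emeasure_return)
  next
    case (Suc n)
    have step: "emeasure (IT.eP n \<omega>) {?x (Suc n)} =
        emeasure (chain_step K z n x) {x n} * indicator {?x n} \<omega>"
      if \<omega>: "\<omega> \<in> space (Pi\<^sub>M {0..<n} ?M)" for \<omega>
    proof -
      have ext: "\<omega> \<in> extensional {0..<n}"
        using \<omega> by (simp add: space_PiM PiE_iff)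
      have eq: "fun_upd \<omega> n a = ?x (Suc n) \<longleftrightarrow> a = x n \<and> \<omega> = ?x n" for a
      proof
        assume h: "fun_upd \<omega> n a = ?x (Suc n)"
        have "a = x n"
          using fun_cong[OF h, of n] by simp
        moreover have "\<omega> j = ?x n j" for j
          using fun_cong[OF h, of j] ext by (cases "j < n") (auto simp: extensional_def)
        ultimately show "a = x n \<and> \<omega> = ?x n"
          by auto
      next
        assume "a = x n \<and> \<omega> = ?x n"
        then show "fun_upd \<omega> n a = ?x (Suc n)"
          by (auto simp: fun_eq_iff restrict_def)
      qed
      have past: "chain_step K z n (?x n) = chain_step K z n x"
        by (cases n) (auto simp: chain_step_def)
      have "emeasure (IT.eP n \<omega>) {?x (Suc n)} =
          emeasure (chain_step K z n \<omega>) ((\<lambda>a. fun_upd \<omega> n a) -` {?x (Suc n)} \<inter> UNIV)"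
        using IT.emeasure_eP[OF \<omega> x_sets] by simp
      also have "(\<lambda>a. fun_upd \<omega> n a) -` {?x (Suc n)} \<inter> UNIV = (if \<omega> = ?x n then {x n} else {})"
        using eq by auto
      finally show ?thesis
        using past by (cases "\<omega> = ?x n") (simp_all only: if_True if_False
            indicator_simps insertI1 singleton_iff mult_1_right mult_zero_right emeasure_empty simp_thms)
    qed
    have "emeasure (IT.C 0 (Suc n) (\<lambda>_. undefined)) {?x (Suc n)} =
        (\<integral>\<^sup>+\<omega>. emeasure (IT.eP n \<omega>) {?x (Suc n)} \<partial>IT.C 0 n (\<lambda>_. undefined))"
      unfolding IT.C.simps add_0
    proof (rule emeasure_bind)
      show "space (IT.C 0 n (\<lambda>_. undefined)) \<noteq> {}"
        using IT.space_C[OF undef, of n] x_space[of n] by auto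
      show "IT.eP n \<in> measurable (IT.C 0 n (\<lambda>_. undefined)) (subprob_algebra (Pi\<^sub>M {0..<Suc n} ?M))"
        unfolding measurable_cong_sets[OF sets_C refl] by (rule IT.measurable_eP)
      show "{?x (Suc n)} \<in> sets (Pi\<^sub>M {0..<Suc n} ?M)"
        by (rule x_sets)
    qed
    also have "\<dots> = (\<integral>\<^sup>+\<omega>. emeasure (chain_step K z n x) {x n} * indicator {?x n} \<omega>
        \<partial>IT.C 0 n (\<lambda>_. undefined))"
      by (rule nn_integral_cong) (simp add: IT.space_C[OF undef] step)
    also have "\<dots> = emeasure (chain_step K z n x) {x n} * emeasure (IT.C 0 n (\<lambda>_. undefined)) {?x n}"
      by (rule nn_integral_cmult_indicator) (simp only: sets_C x_sets)
    finally show ?case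
      unfolding Suc by (simp only: prod.lessThan_Suc mult.commute)
  qed
  have "emeasure (chain_law K z) {\<omega>. \<forall>i\<le>n. \<omega> i = x i} =
      emeasure IT.PF.lim (IT.PF.emb UNIV {0..<Suc n} {?x (Suc n)})"
    unfolding law
    by (rule arg_cong[where f="emeasure _"])
      (auto simp: prod_emb_def fun_eq_iff restrict_def less_Suc_eq_le space_PiM, metis)
  also have "\<dots> = emeasure (IT.CI {0..<Suc n}) {?x (Suc n)}"
    by (rule IT.lim) (auto simp only: x_sets finite_atLeastLessThan)
  also have "\<dots> = emeasure (IT.C 0 (Suc n) (\<lambda>_. undefined))
      (IT.PF.emb {0..<Suc n} {0..<Suc n} {?x (Suc n)})"
    by (rule IT.emeasure_CI) (simp_all only: x_sets order_refl)
  also have "IT.PF.emb {0..<Suc n} {0..<Suc n} {?x (Suc n)} = {?x (Suc n)}"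
    by (rule prod_emb_id) auto
  also have "emeasure (IT.C 0 (Suc n) (\<lambda>_. undefined)) {?x (Suc n)} =
      emeasure (return_pmf z) {x 0} * (\<Prod>i<n. emeasure (K (x i)) {x (Suc i)})"
    unfolding C prod.lessThan_Suc_shift by (simp add: chain_step_def)
  also have "\<dots> = ennreal (if x 0 = z then \<Prod>i<n. pmf (K (x i)) (x (Suc i)) else 0)"
    by (auto simp: emeasure_pmf_single prod_ennreal)
  finally show "emeasure (chain_law K z) {\<omega>. \<forall>i\<le>n. \<omega> i = x i} =
       ennreal (if x 0 = z then \<Prod>i<n. pmf (K (x i)) (x (Suc i)) else 0)" .
  have "distr IT.PF.lim (Pi\<^sub>M {} ?M) (\<lambda>x. restrict x {}) = IT.CI {}"
    by (rule IT.distr_lim) simp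
  moreover have "prob_space (IT.CI {})"
    by (rule IT.PF.prob_space_P) auto
  ultimately have "prob_space (distr IT.PF.lim (Pi\<^sub>M {} ?M) (\<lambda>x. restrict x {}))"
    by simp
  then show "prob_space (chain_law K z)"
    unfolding law
    by (rule prob_space_distrD[rotated])
      (auto simp: measurable_cong_sets[OF IT.PF.sets_lim refl] intro!: measurable_restrict)
qed

lemma pmf_lazy_kernel:
  assumes G: "finite_weighted_graph V E \<mu>" and "1 < card V" and x: "x \<in> V"
  shows "pmf (lazy_kernel E \<mu> x) y = lazy_transition E \<mu> x y"
proof -
  let ?N = "{y. {x, y} \<in> E}"
  have fin: "finite V" and E: "E \<subseteq> {{x, y} | x y. x \<in> V \<and> y \<in> V \<and> x \<noteq> y}"
    and conn: "\<And>y. y \<in> V \<Longrightarrow> (x, y) \<in> (edge_rel E)\<^sup>*"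
    and nonneg: "\<And>x y. 0 \<le> \<mu> x y" and pos: "\<And>x y. 0 < \<mu> x y \<longleftrightarrow> {x, y} \<in> E"
    using G x unfolding finite_weighted_graph_def by blast+
  have N: "?N \<subseteq> V" and xN: "x \<notin> ?N"
    using E by (auto simp: doubleton_eq_iff)
  then have finN: "finite ?N"
    using fin finite_subset by blast
  obtain y' where "y' \<in> V" "y' \<noteq> x"
    using \<open>1 < card V\<close> x fin
    by (metis One_nat_def card_1_singleton_iff insertI1 is_singletonI' is_singleton_altdef less_irrefl empty_iff)
  then have "\<exists>w. {x, w} \<in> E"
    using conn[of y'] by (auto elim: converse_rtranclE simp: edge_rel_def)
  then have wpos: "0 < vertex_weight E \<mu> x"
    unfolding vertex_weight_def using finN pos by (intro sum_pos) auto
  have zero: "lazy_transition E \<mu> x y = 0" if "y \<notin> insert x ?N" for y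
    using that pos[of x y] nonneg[of x y] by (auto simp: lazy_transition_def transition_def)
  have ge0: "0 \<le> lazy_transition E \<mu> x y" for y
    using nonneg wpos by (auto simp: lazy_transition_def transition_def)
  have "(\<Sum>y\<in>insert x ?N. lazy_transition E \<mu> x y) = 1 / 2 + (\<Sum>y\<in>?N. lazy_transition E \<mu> x y)"
    using finN xN by (simp add: lazy_transition_def)
  also have "(\<Sum>y\<in>?N. lazy_transition E \<mu> x y) = (\<Sum>y\<in>?N. \<mu> x y / vertex_weight E \<mu> x / 2)"
    using xN by (intro sum.cong) (auto simp: lazy_transition_def transition_def)
  also have "\<dots> = vertex_weight E \<mu> x / vertex_weight E \<mu> x / 2"
    unfolding sum_divide_distrib[symmetric] by (simp add: vertex_weight_def)
  also have "\<dots> = 1 / 2"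
    using wpos by simp
  finally have sum1: "(\<Sum>y\<in>insert x ?N. lazy_transition E \<mu> x y) = 1"
    by simp
  have "(\<integral>\<^sup>+y. ennreal (lazy_transition E \<mu> x y) \<partial>count_space UNIV) =
      (\<Sum>y\<in>insert x ?N. ennreal (lazy_transition E \<mu> x y))"
    using finN zero by (intro nn_integral_count_space') auto
  also have "\<dots> = 1"
    using ge0 sum1 by (simp add: sum_ennreal del: sum.insert)
  finally show ?thesis
    unfolding lazy_kernel_def using ge0 by (intro pmf_embed_pmf)
qed

end

theory Submission
  imports Defs "HOL-Real_Asymp.Real_Asymp"
begin

text \<open>
  The walk covers the graph within time of order $T = D^{d_w}$, $D$ the diameter, because it
  spreads its local time evenly over every scale, and in the strongly recurrent regime
  $d_f < d_w$ the spreading becomes more reliable as the scale shrinks. The mechanism is a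
  chaining over geometrically decreasing scales, so the logarithm that a union bound over all vertices would
  cost never appears.

  Let $p_n(x,w)$ be the heat kernel of the non-lazy walk (\<open>heat\<close>), $\hat p_n = p_n + p_{n+1}$
  (\<open>heat2\<close>), and let the local time at scale $n$ be $L_n(x) = \sum_{s<t} \hat p_n(x, X_s)$, where
  $X$ is the lazy walk. For large $n$ this is an average of the occupation over a ball around $x$;
  for $n = 0$ it is a weighted count of the visits to $x$ and its neighbours.

  Two neighbouring scales $n < k$ are compared by an exponential supermartingale. The function
  $g = \sum_{n \le i < k} \hat p_i(x, \cdot)$ satisfies $(I - P) g = \hat p_n(x,\cdot) - \hat p_k(x,\cdot)$,
  and if $0 \le g \le G$ then $1 - g / (2 G)$ is superharmonic after reweighting, which yields
  (\<open>occupation_deviation\<close>)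
  \[ P_z (L_k(x) \ge b,\ L_n(x) \le b/4) \le 2 e^{-b/(8G)} \]
  at every fixed time $t$, with no stopping time and no restart of the walk.

  The parabolic Harnack inequality, applied to the heat kernel, supplies three things: the bound
  $\hat p_n \le C n^{-d_f/d_w}$, hence $G \le C R^{d_w - d_f}$ for scales $n$ and $k$ comparable to
  $R^{d_w}$; a lower bound $\hat p_n \ge c / \mu(V)$ for some $n$ comparable to $D^{d_w}$, by a
  chain of boundedly many balls, so that at the top scale all local times are at least
  $c t / D^{d_f}$ surely; and the comparison of $L$ at different vertices of one ball.
  By the last one, a single vertex that loses local time at scale $R$ forces a whole ball of radius
  $R$ to lose it, so first moments give a union bound with $(D/R)^{d_f}$ terms.

  With $R_i = D \lambda^{-i}$ each scale costs a constant factor $4M$ of local time,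
  and the exponent at scale $i$ is of order
  $(t / T) \cdot (\lambda^{d_w - d_f} / (4M))^i$. Choosing $\lambda$ so large that the last ratio is
  at least $2$, the failure probabilities $\lambda^{i d_f} \exp (- c\, 2^i\, t/T)$ sum to
  $C e^{-c t / T}$ for $t \ge T$ (\<open>prob_uncovered_le_sum\<close>, \<open>doubling_exponential_sum_bound\<close>). The
  last comparison is with $p_0(x, \cdot)$ itself, whose local time is zero exactly when $x$ has not been
  visited. The Harnack inequality
  is empty on the finitely many graphs of small diameter, and there the same supermartingale
  argument with Cesaro sums of the heat kernel gives an exponential tail with constants depending
  on the graph (\<open>cover_time_tail_exponential\<close>).
\<close>

section \<open>Multiplicative functionals of a finite Markov chain\<close>

definition path_op :: "'a set \<Rightarrow> ('a \<Rightarrow> 'a \<Rightarrow> real) \<Rightarrow> ('a \<Rightarrow> real) \<Rightarrow> 'a \<Rightarrow> real" where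
  "path_op V k f x = (\<Sum>y\<in>V. k x y * f y)"

text \<open>
  Feynman--Kac for finite state spaces: summing products of edge weights over all trajectories is
  iterating the weight matrix.
\<close>

lemma sum_over_paths:
  fixes k :: "'a \<Rightarrow> 'a \<Rightarrow> real"
  assumes "finite V" and "z \<in> V"
  shows "(\<Sum>x\<in>PiE {..t} (\<lambda>_. V). (if x 0 = z then (\<Prod>i<t. k (x i) (x (Suc i))) else 0) * f (x t))
    = (path_op V k ^^ t) f z"
proof (induction t arbitrary: f)
  case 0
  have "bij_betw (\<lambda>a. \<lambda>i\<in>{..0::nat}. a) V (PiE {..0} (\<lambda>_. V))"
    by (rule bij_betw_byWitness[where f' = "\<lambda>x. x 0"])
      (auto simp: restrict_def PiE_iff extensional_def fun_eq_iff split: if_splits)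
  from sum.reindex_bij_betw[OF this, of "\<lambda>x. (if x 0 = z then 1 else 0) * f (x 0)"]
  have "(\<Sum>x\<in>PiE {..0::nat} (\<lambda>_. V). (if x 0 = z then 1 else 0) * f (x 0)) =
      (\<Sum>a\<in>V. (if a = z then 1 else 0) * f a)"
    by simp
  also have "\<dots> = (\<Sum>a\<in>V. if a = z then f a else 0)"
    by (rule sum.cong) auto
  also have "\<dots> = f z"
    using assms by simp
  finally show ?case by (simp cong: if_cong)
next
  case (Suc t)
  let ?w = "\<lambda>n x. if x 0 = z then (\<Prod>i<n. k (x i) (x (Suc i))) else (0::real)"
  have "(\<Sum>x\<in>PiE {..Suc t} (\<lambda>_. V). ?w (Suc t) x * f (x (Suc t))) =
     (\<Sum>(y, g)\<in>V \<times> PiE {..t} (\<lambda>_. V). ?w (Suc t) (g(Suc t := y)) * f y)"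
    unfolding atMost_Suc PiE_insert_eq
    using inj_combinator[of "Suc t" "{..t}" "\<lambda>_. V"]
    by (subst sum.reindex) (auto simp: split_def)
  also have "\<dots> = (\<Sum>y\<in>V. \<Sum>g\<in>PiE {..t} (\<lambda>_. V). ?w t g * (k (g t) y * f y))"
    unfolding sum.cartesian_product[symmetric]
    by (intro sum.cong refl) (auto simp: mult.assoc intro!: prod.cong)
  also have "\<dots> = (\<Sum>g\<in>PiE {..t} (\<lambda>_. V). ?w t g * path_op V k f (g t))"
    unfolding path_op_def sum_distrib_left by (rule sum.swap)
  also have "\<dots> = (path_op V k ^^ t) (path_op V k f) z"
    by (rule Suc)
  finally show ?case
    by (simp add: funpow_swap1)
qed

lemma path_op_power_le:
  assumes "\<And>x y. x \<in> V \<Longrightarrow> y \<in> V \<Longrightarrow> 0 \<le> k x y"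
    and "\<And>x. x \<in> V \<Longrightarrow> path_op V k f x \<le> f x" and "z \<in> V"
  shows "(path_op V k ^^ t) f z \<le> f z"
  using \<open>z \<in> V\<close>
proof (induction t arbitrary: z)
  case (Suc t)
  have "path_op V k ((path_op V k ^^ t) f) z \<le> path_op V k f z"
    unfolding path_op_def[of _ _ _ z] using Suc assms(1) by (intro sum_mono mult_left_mono) auto
  then show ?case
    using assms(2)[OF Suc.prems] by simp
qed simp

locale finite_chain =
  fixes V :: "'a set" and K :: "'a \<Rightarrow> 'a pmf" and z :: 'a
  assumes finite_V: "finite V" and start: "z \<in> V"
    and step_in: "\<And>x. x \<in> V \<Longrightarrow> set_pmf (K x) \<subseteq> V"
begin

abbreviation law :: "(nat \<Rightarrow> 'a) measure" where "law \<equiv> chain_law K z"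

sublocale prob_space law
  by (rule prob_space_chain_law)

lemma space_law [simp]: "space law = UNIV"
  using sets_eq_imp_space_eq[OF sets_chain_law[of K z]] by (simp add: space_PiM)

lemma measurable_coordinate [measurable]: "(\<lambda>\<omega>. \<omega> i) \<in> measurable law (count_space UNIV)"
  unfolding measurable_cong_sets[OF sets_chain_law refl]
  by (rule measurable_component_singleton) simp

lemma pred_coordinate [measurable]: "Measurable.pred law (\<lambda>\<omega>. P (\<omega> i))"
  by (rule measurable_compose[OF measurable_coordinate]) simp

lemma borel_coordinate [measurable]: "(\<lambda>\<omega>. f (\<omega> i) :: real) \<in> borel_measurable law"
  by (rule measurable_compose[OF measurable_coordinate]) simp

lemma cylinder_event: "{\<omega>. \<forall>i\<le>n. \<omega> i = x i} \<in> sets law"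
proof -
  have "{\<omega>\<in>space law. \<forall>i\<in>{..n}. \<omega> i = x i} \<in> sets law"
    by measurable
  then show ?thesis by (simp add: Ball_def)
qed

lemma prob_cylinder:
  "prob {\<omega>. \<forall>i\<le>n. \<omega> i = x i} = (if x 0 = z then \<Prod>i<n. pmf (K (x i)) (x (Suc i)) else 0)"
  unfolding measure_def emeasure_chain_law by (auto simp: prod_nonneg)

lemma prob_path_event:
  "prob {\<omega>. (\<forall>s\<le>t. \<omega> s \<in> V) \<and> Q (restrict \<omega> {..t})} =
    (\<Sum>x | x \<in> PiE {..t} (\<lambda>_. V) \<and> Q x. if x 0 = z then \<Prod>i<t. pmf (K (x i)) (x (Suc i)) else 0)"
proof -
  let ?X = "{x. x \<in> PiE {..t} (\<lambda>_. V) \<and> Q x}"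
  have eq: "{\<omega>. (\<forall>s\<le>t. \<omega> s \<in> V) \<and> Q (restrict \<omega> {..t})} = (\<Union>x\<in>?X. {\<omega>. \<forall>i\<le>t. \<omega> i = x i})"
  proof (intro set_eqI iffI)
    fix \<omega> assume "\<omega> \<in> {\<omega>. (\<forall>s\<le>t. \<omega> s \<in> V) \<and> Q (restrict \<omega> {..t})}"
    then show "\<omega> \<in> (\<Union>x\<in>?X. {\<omega>. \<forall>i\<le>t. \<omega> i = x i})"
      by (intro UN_I[of "restrict \<omega> {..t}"]) auto
  next
    fix \<omega> assume "\<omega> \<in> (\<Union>x\<in>?X. {\<omega>. \<forall>i\<le>t. \<omega> i = x i})"
    then obtain x where x: "x \<in> PiE {..t} (\<lambda>_. V)" "Q x" "\<And>i. i \<le> t \<Longrightarrow> \<omega> i = x i" by blast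
    then have "restrict \<omega> {..t} = x"
      by (auto simp: fun_eq_iff restrict_def PiE_iff extensional_def)
    then show "\<omega> \<in> {\<omega>. (\<forall>s\<le>t. \<omega> s \<in> V) \<and> Q (restrict \<omega> {..t})}"
      using x by (auto simp: PiE_iff)
  qed
  have fin: "finite ?X"
    by (rule finite_subset[of _ "PiE {..t} (\<lambda>_. V)"]) (auto intro!: finite_PiE finite_V)
  have disj: "disjoint_family_on (\<lambda>x. {\<omega>. \<forall>i\<le>t. \<omega> i = x i}) ?X"
    unfolding disjoint_family_on_def
  proof (intro ballI impI)
    fix x y assume xy: "x \<in> ?X" "y \<in> ?X" "x \<noteq> y"
    then obtain i where "i \<le> t" "x i \<noteq> y i"
      by (auto simp: PiE_iff extensional_def fun_eq_iff) (metis atMost_iff)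
    then show "{\<omega>. \<forall>i\<le>t. \<omega> i = x i} \<inter> {\<omega>. \<forall>i\<le>t. \<omega> i = y i} = {}"
      by auto
  qed
  show ?thesis
    unfolding eq
    by (subst finite_measure_finite_Union[OF fin _ disj]) (auto simp: cylinder_event prob_cylinder)
qed

lemma prob_stays_in_V: "prob {\<omega>. \<forall>s\<le>t. \<omega> s \<in> V} = 1"
proof -
  have one: "path_op V (\<lambda>x y. pmf (K x) y) (\<lambda>_. 1) x = 1" if "x \<in> V" for x
    unfolding path_op_def using sum_pmf_eq_1[OF finite_V step_in[OF that]] by simp
  have "(path_op V (\<lambda>x y. pmf (K x) y) ^^ t) (\<lambda>_. 1) x = 1" if "x \<in> V" for x
    using that
  proof (induction t arbitrary: x)
    case (Suc t)
    have "path_op V (\<lambda>x y. pmf (K x) y) ((path_op V (\<lambda>x y. pmf (K x) y) ^^ t) (\<lambda>_. 1)) x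
        = path_op V (\<lambda>x y. pmf (K x) y) (\<lambda>_. 1) x"
      unfolding path_op_def[of _ _ _ x] using Suc by (intro sum.cong) auto
    then show ?case using one[OF Suc.prems] by simp
  qed simp
  from this[OF start] show ?thesis
    using prob_path_event[of t "\<lambda>_. True"]
      sum_over_paths[OF finite_V start, where t = t and k = "\<lambda>x y. pmf (K x) y" and f = "\<lambda>_. 1"]
    by (simp add: mult_1_right)
qed

text \<open>
  The only tool from martingale theory that is used: if $f$ is superharmonic for the kernel reweighted by
  $w$, then $f(X_t) \prod_{s<t} w(X_s)$ has expectation at most $f(z)$, and Markov's inequality
  applies. The weight $w$ rewards or penalises the sites that are visited, which turns a Poisson
  equation into a bound on occupation times.
\<close>

lemma prob_multiplicative_functional_ge:
  assumes f: "\<And>x. x \<in> V \<Longrightarrow> 0 \<le> f x" and w: "\<And>x. x \<in> V \<Longrightarrow> 0 \<le> w x"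
    and super: "\<And>x. x \<in> V \<Longrightarrow> w x * (\<Sum>y\<in>V. pmf (K x) y * f y) \<le> f x"
    and "0 < c"
  shows "prob {\<omega>. (\<forall>s\<le>t. \<omega> s \<in> V) \<and> c \<le> f (\<omega> t) * (\<Prod>s<t. w (\<omega> s))} \<le> f z / c"
proof -
  let ?k = "\<lambda>x y. w x * pmf (K x) y"
  let ?W = "\<lambda>x. if x 0 = z then \<Prod>i<t. pmf (K (x i)) (x (Suc i)) else 0"
  let ?F = "\<lambda>x. f (x t) * (\<Prod>s<t. w (x s))"
  have F: "?F (restrict \<omega> {..t}) = ?F \<omega>" for \<omega>
    by (auto intro!: prod.cong)
  have nn: "0 \<le> ?W x * ?F x" "0 \<le> ?W x" if "x \<in> PiE {..t} (\<lambda>_. V)" for x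
    using that f w by (auto intro!: mult_nonneg_nonneg prod_nonneg simp: PiE_iff)
  have "prob {\<omega>. (\<forall>s\<le>t. \<omega> s \<in> V) \<and> c \<le> ?F \<omega>} =
      (\<Sum>x | x \<in> PiE {..t} (\<lambda>_. V) \<and> c \<le> ?F x. ?W x)"
    using prob_path_event[of t "\<lambda>x. c \<le> ?F x"] unfolding F .
  also have "\<dots> \<le> (\<Sum>x | x \<in> PiE {..t} (\<lambda>_. V) \<and> c \<le> ?F x. ?W x * ?F x / c)"
  proof (rule sum_mono)
    fix x assume "x \<in> {x. x \<in> PiE {..t} (\<lambda>_. V) \<and> c \<le> ?F x}"
    then have "0 \<le> ?W x" "c \<le> ?F x" using nn by auto
    then have "?W x * c \<le> ?W x * ?F x" by (intro mult_left_mono)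
    then show "?W x \<le> ?W x * ?F x / c" using \<open>0 < c\<close> by (simp only: pos_le_divide_eq)
  qed
  also have "\<dots> \<le> (\<Sum>x\<in>PiE {..t} (\<lambda>_. V). ?W x * ?F x / c)"
    using nn(1) \<open>0 < c\<close>
    by (intro sum_mono2) (auto intro!: finite_PiE finite_V divide_nonneg_pos simp del: times_divide_eq_right)
  also have "\<dots> = (\<Sum>x\<in>PiE {..t} (\<lambda>_. V).
      (if x 0 = z then (\<Prod>i<t. ?k (x i) (x (Suc i))) else 0) * f (x t)) / c"
    unfolding sum_divide_distrib by (intro sum.cong) (auto simp: prod.distrib)
  also have "\<dots> = (path_op V ?k ^^ t) f z / c"
    by (subst sum_over_paths[OF finite_V start]) simp
  also have "\<dots> \<le> f z / c"
    using w super \<open>0 < c\<close>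
    by (intro divide_right_mono path_op_power_le start)
      (auto simp: path_op_def sum_distrib_left mult.assoc)
  finally show ?thesis .
qed

end

text \<open>
  A union bound in which the number of terms is the number of balls rather than of points: an
  event that always comes with a set of weight $v$ of failing vertices has probability at most the
  expected failing weight divided by $v$.
\<close>

lemma (in prob_space) prob_le_of_large_weight:
  assumes "finite V" and m: "\<And>y. y \<in> V \<Longrightarrow> 0 \<le> m y" and "0 < v"
    and N: "\<And>y. y \<in> V \<Longrightarrow> N y \<in> events" and \<epsilon>: "\<And>y. y \<in> V \<Longrightarrow> prob (N y) \<le> \<epsilon>"
    and W: "\<And>\<omega>. \<omega> \<in> A \<Longrightarrow> \<omega> \<in> space M \<and> (\<exists>W\<subseteq>V. v \<le> sum m W \<and> (\<forall>y\<in>W. \<omega> \<in> N y))"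
  shows "prob A \<le> sum m V * \<epsilon> / v"
proof -
  let ?u = "\<lambda>\<omega>. \<Sum>y\<in>V. m y * indicator (N y) \<omega>"
  note N[measurable]
  have int: "integrable M (\<lambda>\<omega>. m y * indicator (N y) \<omega>)" if "y \<in> V" for y
    using N[OF that] by (intro integrable_mult_right integrable_real_indicator) (auto simp: emeasure_eq_measure)
  have "A \<subseteq> {\<omega> \<in> space M. v \<le> ?u \<omega>}"
  proof
    fix \<omega> assume "\<omega> \<in> A"
    from W[OF this] obtain W where \<omega>: "\<omega> \<in> space M" and W: "W \<subseteq> V" "v \<le> sum m W"
      and N: "\<forall>y\<in>W. \<omega> \<in> N y"
      by (elim conjE exE)
    have "sum m W = (\<Sum>y\<in>W. m y * indicator (N y) \<omega>)"
      using N by (intro sum.cong) auto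
    also have "\<dots> \<le> ?u \<omega>"
      using W(1) m \<open>finite V\<close> by (intro sum_mono2) auto
    finally show "\<omega> \<in> {\<omega> \<in> space M. v \<le> ?u \<omega>}" using W(2) \<omega> by simp
  qed
  then have "prob A \<le> prob {\<omega> \<in> space M. v \<le> ?u \<omega>}"
    by (rule finite_measure_mono) measurable
  also have "\<dots> \<le> (\<integral>\<omega>. ?u \<omega> \<partial>M) / v"
    using \<open>0 < v\<close> m
    by (intro integral_Markov_inequality_measure[where A = "space M"]
        Bochner_Integration.integrable_sum int) (auto intro!: AE_I2 sum_nonneg)
  also have "(\<integral>\<omega>. ?u \<omega> \<partial>M) = (\<Sum>y\<in>V. \<integral>\<omega>. m y * indicator (N y) \<omega> \<partial>M)"
    by (rule Bochner_Integration.integral_sum) (rule int)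
  also have "\<dots> = (\<Sum>y\<in>V. m y * prob (N y))"
    using N by (intro sum.cong) (auto simp: Int_absorb2 sets.sets_into_space)
  also have "\<dots> \<le> sum m V * \<epsilon>"
    unfolding sum_distrib_right using m \<epsilon> by (intro sum_mono mult_left_mono) auto
  finally show ?thesis using \<open>0 < v\<close> by (auto simp: divide_right_mono)
qed

section \<open>The heat kernel of a weighted graph\<close>

locale weighted_graph =
  fixes V :: "'a set" and E :: "'a set set" and \<mu> :: "'a \<Rightarrow> 'a \<Rightarrow> real"
  assumes graph: "finite_weighted_graph V E \<mu>" and card_V: "1 < card V"
begin

abbreviation m :: "'a \<Rightarrow> real" where "m \<equiv> vertex_weight E \<mu>"
abbreviation P :: "'a \<Rightarrow> 'a \<Rightarrow> real" where "P \<equiv> transition E \<mu>"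

lemma finite_V: "finite V"
  and connected: "x \<in> V \<Longrightarrow> y \<in> V \<Longrightarrow> (x, y) \<in> (edge_rel E)\<^sup>*"
  and mu_nonneg: "0 \<le> \<mu> x y" and mu_sym: "\<mu> x y = \<mu> y x"
  and mu_pos_iff: "0 < \<mu> x y \<longleftrightarrow> {x, y} \<in> E"
  using graph unfolding finite_weighted_graph_def by blast+

lemma edge_in_V: "{x, y} \<in> E \<Longrightarrow> x \<in> V \<and> y \<in> V \<and> x \<noteq> y"
  using graph unfolding finite_weighted_graph_def by (auto simp: doubleton_eq_iff)

lemma mu_eq_0: "{x, y} \<notin> E \<Longrightarrow> \<mu> x y = 0"
  using mu_pos_iff[of x y] mu_nonneg[of x y] by linarith

lemma m_eq: "m x = (\<Sum>y\<in>V. \<mu> x y)"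
  unfolding vertex_weight_def
  by (rule sum.mono_neutral_left) (use finite_V edge_in_V mu_eq_0 in auto)

lemma exists_neighbour:
  assumes "x \<in> V" shows "\<exists>y. {x, y} \<in> E"
proof -
  have "V \<noteq> {x}"
    using card_V by auto
  then obtain y where "y \<in> V" "y \<noteq> x"
    using assms by blast
  with connected[OF assms \<open>y \<in> V\<close>] show ?thesis
    by (auto elim: converse_rtranclE simp: edge_rel_def)
qed

lemma m_ge_mu: "x \<in> V \<Longrightarrow> {x, y} \<in> E \<Longrightarrow> \<mu> x y \<le> m x"
  unfolding m_eq using edge_in_V finite_V mu_nonneg by (intro member_le_sum) auto

lemma m_pos: "x \<in> V \<Longrightarrow> 0 < m x"
  using exists_neighbour m_ge_mu mu_pos_iff by (metis less_le_trans)

lemma m_nonneg: "0 \<le> m x"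
  unfolding m_eq by (simp add: sum_nonneg mu_nonneg)

lemma P_nonneg: "0 \<le> P x y"
  by (simp add: transition_def mu_nonneg m_nonneg)

lemma sum_P: "x \<in> V \<Longrightarrow> (\<Sum>y\<in>V. P x y) = 1"
  using m_pos[of x] by (simp add: transition_def sum_divide_distrib[symmetric] m_eq[symmetric])

lemma P_refl: "P x x = 0"
  using edge_in_V[of x x] mu_eq_0[of x x] by (auto simp: transition_def)

lemma m_P: "x \<in> V \<Longrightarrow> m x * P x y = \<mu> x y"
  using m_pos[of x] by (simp add: transition_def)

lemma sum_P_le:
  assumes "x \<in> V" and "\<And>y. y \<in> V \<Longrightarrow> f y \<le> C"
  shows "(\<Sum>y\<in>V. P x y * f y) \<le> C"
proof -
  have "(\<Sum>y\<in>V. P x y * f y) \<le> (\<Sum>y\<in>V. P x y * C)"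
    using assms P_nonneg by (intro sum_mono mult_left_mono) auto
  then show ?thesis
    using assms by (simp add: sum_distrib_right[symmetric] sum_P)
qed

text \<open>
  The transition density $P^n(x,z) / \mu_z$ of the non-lazy walk, built by the backward
  recursion in $z$, so that $(n, z) \mapsto p_n(x,z)$ solves the equation of the Harnack inequality.
\<close>

primrec heat :: "nat \<Rightarrow> 'a \<Rightarrow> 'a \<Rightarrow> real" where
  "heat 0 x z = (if z = x then inverse (m x) else 0)"
| "heat (Suc n) x z = (\<Sum>y\<in>V. P z y * heat n x y)"

lemma heat_nonneg: "0 \<le> heat n x z"
  by (induction n arbitrary: z) (auto intro!: sum_nonneg mult_nonneg_nonneg simp: m_nonneg P_nonneg)

lemma heat_mass:
  assumes "x \<in> V" shows "(\<Sum>z\<in>V. m z * heat n x z) = 1"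
proof (induction n)
  case 0
  have "(\<Sum>z\<in>V. m z * heat 0 x z) = (\<Sum>z\<in>V. if z = x then 1 else 0)"
    using m_pos[OF assms] by (intro sum.cong) auto
  then show ?case using finite_V assms by simp
next
  case (Suc n)
  have "(\<Sum>z\<in>V. m z * heat (Suc n) x z) = (\<Sum>z\<in>V. \<Sum>y\<in>V. \<mu> z y * heat n x y)"
    by (simp add: sum_distrib_left mult.assoc[symmetric] m_P)
  also have "\<dots> = (\<Sum>y\<in>V. \<Sum>z\<in>V. \<mu> y z * heat n x y)"
    by (subst sum.swap) (simp add: mu_sym)
  also have "\<dots> = (\<Sum>y\<in>V. m y * heat n x y)"
    by (simp add: sum_distrib_right[symmetric] m_eq[symmetric])
  finally show ?case using Suc by simp
qed

text \<open>
  Reversibility enters here: stepping at the starting point gives the same kernel as stepping at the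
  end point.
\<close>

lemma heat_Suc_left:
  assumes "x \<in> V" "z \<in> V"
  shows "heat (Suc n) x z = (\<Sum>y\<in>V. P x y * heat n y z)"
  using assms(2)
proof (induction n arbitrary: z)
  case 0
  have "heat (Suc 0) x z = (\<Sum>y\<in>V. if y = x then P z x * inverse (m x) else 0)"
    by (auto intro!: sum.cong)
  also have "\<dots> = P z x * inverse (m x)"
    using finite_V assms by simp
  also have "\<dots> = P x z * inverse (m z)"
    using m_pos[of x] m_pos[of z] assms 0 mu_sym[of x z] by (simp add: transition_def field_simps)
  also have "\<dots> = (\<Sum>y\<in>V. if z = y then P x z * inverse (m z) else 0)"
    using finite_V 0 by simp
  also have "\<dots> = (\<Sum>y\<in>V. P x y * heat 0 y z)"
    by (auto intro!: sum.cong)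
  finally show ?case .
next
  case (Suc n)
  have "heat (Suc (Suc n)) x z = (\<Sum>w\<in>V. P z w * (\<Sum>y\<in>V. P x y * heat n y w))"
    unfolding heat.simps(2)[of "Suc n"] using Suc.IH by simp
  also have "\<dots> = (\<Sum>y\<in>V. \<Sum>w\<in>V. P x y * (P z w * heat n y w))"
    unfolding sum_distrib_left by (subst sum.swap) (simp add: mult.left_commute)
  finally show ?case
    by (simp add: sum_distrib_left)
qed

lemma heat_sym: "x \<in> V \<Longrightarrow> z \<in> V \<Longrightarrow> heat n x z = heat n z x"
proof (induction n arbitrary: x z)
  case (Suc n)
  then show ?case
    unfolding heat_Suc_left[OF Suc.prems] by simp
qed auto

text \<open>
  Averaging by the transition matrix cannot increase a supremum.
\<close>

lemma heat_le_later:
  assumes "\<And>y. y \<in> V \<Longrightarrow> heat n x y \<le> C" and "n \<le> k" and "z \<in> V"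
  shows "heat k x z \<le> C"
  using assms(2,3)
proof (induction k arbitrary: z rule: dec_induct)
  case (step k)
  then show ?case by (simp add: sum_P_le)
qed (rule assms(1))

declare heat.simps [simp del]

text \<open>
  On a bipartite graph $p_n(x,z)$ vanishes for one parity of $n$; adding two consecutive times
  removes this, and it is the combination on the right-hand side of the Harnack inequality.
\<close>

definition heat2 :: "nat \<Rightarrow> 'a \<Rightarrow> 'a \<Rightarrow> real" where
  "heat2 n x z = heat n x z + heat (Suc n) x z"

lemma heat2_nonneg: "0 \<le> heat2 n x z"
  by (simp add: heat2_def heat_nonneg)

lemma heat2_sym: "x \<in> V \<Longrightarrow> z \<in> V \<Longrightarrow> heat2 n x z = heat2 n z x"
  unfolding heat2_def by (metis heat_sym)

lemma heat2_mass: "x \<in> V \<Longrightarrow> (\<Sum>z\<in>V. m z * heat2 n x z) = 2"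
  unfolding heat2_def by (simp add: distrib_left sum.distrib heat_mass)

text \<open>
  Telescoping: a block of the Green function solves the Poisson equation whose source is the
  difference of two heat kernels.
\<close>

lemma heat_sum_poisson:
  assumes "S \<le> T"
  shows "(\<Sum>i\<in>{S..<T}. heat i x z) - (\<Sum>y\<in>V. P z y * (\<Sum>i\<in>{S..<T}. heat i x y)) = heat S x z - heat T x z"
proof -
  have "(\<Sum>y\<in>V. P z y * (\<Sum>i\<in>{S..<T}. heat i x y)) = (\<Sum>i\<in>{S..<T}. heat (Suc i) x z)"
    unfolding sum_distrib_left by (subst sum.swap) (simp add: heat.simps sum_distrib_left)
  then have "(\<Sum>i\<in>{S..<T}. heat i x z) - (\<Sum>y\<in>V. P z y * (\<Sum>i\<in>{S..<T}. heat i x y))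
      = (\<Sum>i\<in>{S..<T}. heat i x z - heat (Suc i) x z)"
    by (simp add: sum_subtractf)
  also have "\<dots> = - (\<Sum>i\<in>{S..<T}. heat (Suc i) x z - heat i x z)"
    by (simp add: sum_negf[symmetric])
  also have "\<dots> = heat S x z - heat T x z"
    by (subst sum_Suc_diff'[OF assms]) simp
  finally show ?thesis .
qed

section \<open>Comparison of occupation times\<close>

abbreviation walk :: "'a \<Rightarrow> (nat \<Rightarrow> 'a) measure" where "walk \<equiv> lazy_walk_law E \<mu>"

lemma sum_lazy_kernel:
  assumes "x \<in> V"
  shows "(\<Sum>y\<in>V. pmf (lazy_kernel E \<mu> x) y * f y) = (f x + (\<Sum>y\<in>V. P x y * f y)) / 2"
proof -
  have "(\<Sum>y\<in>V. pmf (lazy_kernel E \<mu> x) y * f y) =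
      (\<Sum>y\<in>V. (if x = y then f x / 2 else 0) + P x y * f y / 2)"
    using P_refl by (intro sum.cong refl)
      (auto simp: pmf_lazy_kernel[OF graph card_V assms] lazy_transition_def)
  then show ?thesis
    using assms finite_V by (simp add: sum.distrib sum_divide_distrib add_divide_distrib)
qed

lemma finite_chain_lazy: "z \<in> V \<Longrightarrow> finite_chain V (lazy_kernel E \<mu>) z"
proof
  fix x assume "x \<in> V"
  show "set_pmf (lazy_kernel E \<mu> x) \<subseteq> V"
  proof
    fix y assume "y \<in> set_pmf (lazy_kernel E \<mu> x)"
    then have "lazy_transition E \<mu> x y \<noteq> 0"
      using pmf_lazy_kernel[OF graph card_V \<open>x \<in> V\<close>] by (simp add: set_pmf_eq)
    then have "x = y \<or> {x, y} \<in> E"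
      using mu_eq_0[of x y] by (auto simp: lazy_transition_def transition_def split: if_splits)
    then show "y \<in> V" using \<open>x \<in> V\<close> edge_in_V by blast
  qed
qed (use finite_V in auto)

lemma prob_space_walk: "prob_space (walk z)"
  unfolding lazy_walk_law_def by (rule prob_space_chain_law)

text \<open>
  If $g$ solves $(I-P)g = A - B$ and is bounded by $G$, then the walk cannot spend much time on $B$
  and little on $A$. The function $f = 1 - g/(2G)$ takes values in $[1/2,1]$, and one lazy step changes it by
  $(A-B)/(4G)$, which is at most $f\,((A - B/2)/(2G))$; hence $w = \exp((B/2-A)/(2G))$ makes
  $f(X_t) \prod_{s<t} w(X_s)$ a supermartingale, and this quantity is at least
  $\frac12 e^{b/(8G)}$ on the event.
\<close>

lemma occupation_deviation:
  fixes A B g :: "'a \<Rightarrow> real"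
  assumes "z \<in> V" and "0 < G"
    and A: "\<And>x. x \<in> V \<Longrightarrow> 0 \<le> A x" and B: "\<And>x. x \<in> V \<Longrightarrow> 0 \<le> B x"
    and g: "\<And>x. x \<in> V \<Longrightarrow> 0 \<le> g x \<and> g x \<le> G"
    and poisson: "\<And>x. x \<in> V \<Longrightarrow> g x - (\<Sum>y\<in>V. P x y * g y) = A x - B x"
  shows "measure (walk z) {\<omega>. (\<forall>s\<le>t. \<omega> s \<in> V) \<and>
           b \<le> (\<Sum>s<t. B (\<omega> s)) \<and> (\<Sum>s<t. A (\<omega> s)) \<le> b / 4}
    \<le> 2 * exp (- b / (8 * G))"
proof -
  interpret finite_chain V "lazy_kernel E \<mu>" z
    using \<open>z \<in> V\<close> by (rule finite_chain_lazy)
  define f where "f x = 1 - g x / (2 * G)" for x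
  define w where "w x = exp ((B x / 2 - A x) / (2 * G))" for x
  have f: "1 / 2 \<le> f x" "f x \<le> 1" if "x \<in> V" for x
    using g[OF that] \<open>0 < G\<close> by (auto simp: f_def field_simps)
  have super: "w x * (\<Sum>y\<in>V. pmf (lazy_kernel E \<mu> x) y * f y) \<le> f x" if x: "x \<in> V" for x
  proof -
    have "(\<Sum>y\<in>V. P x y * f y) = 1 - (\<Sum>y\<in>V. P x y * g y) / (2 * G)"
      using sum_P[OF x]
      by (simp add: f_def right_diff_distrib sum_subtractf sum_divide_distrib)
    then have "(\<Sum>y\<in>V. pmf (lazy_kernel E \<mu> x) y * f y) = f x + (A x - B x) / (4 * G)"
      using \<open>0 < G\<close> unfolding poisson[OF x, symmetric] sum_lazy_kernel[OF x] \<open>(\<Sum>y\<in>V. P x y * f y) = _\<close>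
      by (simp add: f_def field_simps)
    also have "\<dots> \<le> f x * (1 + (A x - B x / 2) / (2 * G))"
    proof -
      have "A x * 1 \<le> A x * (2 * f x)" "B x * f x \<le> B x * 1"
        using A[OF x] B[OF x] f[OF x] by (intro mult_left_mono; simp)+
      then have "A x - B x \<le> f x * (2 * A x - B x)"
        by (simp add: algebra_simps)
      then have "(A x - B x) / (4 * G) \<le> f x * (2 * A x - B x) / (4 * G)"
        using \<open>0 < G\<close> by (intro divide_right_mono) auto
      also have "\<dots> = f x * ((A x - B x / 2) / (2 * G))"
        using \<open>0 < G\<close> by (simp add: field_simps)
      finally show ?thesis by (simp add: distrib_left)
    qed
    also have "\<dots> \<le> f x * exp ((A x - B x / 2) / (2 * G))"
      using f(1)[OF x] by (intro mult_left_mono exp_ge_add_one_self) simp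
    also have "exp ((A x - B x / 2) / (2 * G)) = inverse (w x)"
      unfolding w_def exp_minus[symmetric] by (simp add: minus_divide_left)
    finally show ?thesis
      by (simp add: w_def field_simps)
  qed
  have "measure (walk z) {\<omega>. (\<forall>s\<le>t. \<omega> s \<in> V) \<and>
           b \<le> (\<Sum>s<t. B (\<omega> s)) \<and> (\<Sum>s<t. A (\<omega> s)) \<le> b / 4}
     \<le> prob {\<omega>. (\<forall>s\<le>t. \<omega> s \<in> V) \<and> exp (b / (8 * G)) / 2 \<le> f (\<omega> t) * (\<Prod>s<t. w (\<omega> s))}"
    unfolding lazy_walk_law_def
  proof (rule finite_measure_mono)
    show "{\<omega>. (\<forall>s\<le>t. \<omega> s \<in> V) \<and> b \<le> (\<Sum>s<t. B (\<omega> s)) \<and> (\<Sum>s<t. A (\<omega> s)) \<le> b / 4}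
      \<subseteq> {\<omega>. (\<forall>s\<le>t. \<omega> s \<in> V) \<and> exp (b / (8 * G)) / 2 \<le> f (\<omega> t) * (\<Prod>s<t. w (\<omega> s))}"
    proof safe
      fix \<omega> assume V: "\<forall>s\<le>t. \<omega> s \<in> V" and b: "b \<le> (\<Sum>s<t. B (\<omega> s))" "(\<Sum>s<t. A (\<omega> s)) \<le> b / 4"
      have "b / (8 * G) \<le> ((\<Sum>s<t. B (\<omega> s)) / 2 - (\<Sum>s<t. A (\<omega> s))) / (2 * G)"
        using b \<open>0 < G\<close> by (simp add: field_simps)
      then have "exp (b / (8 * G)) \<le> (\<Prod>s<t. w (\<omega> s))"
        by (simp add: w_def exp_sum[symmetric] sum_divide_distrib[symmetric] sum_subtractf)
      then have "1 / 2 * exp (b / (8 * G)) \<le> f (\<omega> t) * (\<Prod>s<t. w (\<omega> s))"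
        using f(1)[of "\<omega> t"] V by (intro mult_mono) auto
      then show "exp (b / (8 * G)) / 2 \<le> f (\<omega> t) * (\<Prod>s<t. w (\<omega> s))" by simp
    qed
    have "{\<omega> \<in> space law. (\<forall>s\<in>{..t}. \<omega> s \<in> V) \<and> exp (b / (8 * G)) / 2 \<le> f (\<omega> t) * (\<Prod>s<t. w (\<omega> s))} \<in> events"
      by measurable
    then show "{\<omega>. (\<forall>s\<le>t. \<omega> s \<in> V) \<and> exp (b / (8 * G)) / 2 \<le> f (\<omega> t) * (\<Prod>s<t. w (\<omega> s))} \<in> events"
      by (simp add: Ball_def)
  qed
  also have "\<dots> \<le> f z / (exp (b / (8 * G)) / 2)"
    using super f by (intro prob_multiplicative_functional_ge) (auto simp: w_def intro: order_trans[of _ "1/2"])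
  also have "\<dots> \<le> 1 / (exp (b / (8 * G)) / 2)"
    using f(2)[OF \<open>z \<in> V\<close>] by (intro divide_right_mono) auto
  also have "\<dots> = 2 * exp (- b / (8 * G))"
    by (simp add: exp_minus field_simps)
  finally show ?thesis .
qed

text \<open>
  Only the times $s < t$ are inspected, to match local times, which are sums over $s < t$; this
  enlarges the event. Trajectories that leave
  $V$ form a null set and are excluded, so that estimates of the kernel on $V$ apply along the path.
\<close>

definition uncovered :: "nat \<Rightarrow> (nat \<Rightarrow> 'a) set" where
  "uncovered t = {\<omega>. (\<forall>s\<le>t. \<omega> s \<in> V) \<and> (\<exists>x\<in>V. \<forall>s<t. \<omega> s \<noteq> x)}"

lemma cover_time_tail_le_uncovered:
  assumes "z \<in> V"
  shows "measure (walk z) {\<omega> \<in> space (walk z). enat t < cover_time V \<omega>} \<le> measure (walk z) (uncovered t)"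
proof -
  interpret finite_chain V "lazy_kernel E \<mu>" z
    using \<open>z \<in> V\<close> by (rule finite_chain_lazy)
  let ?S = "{\<omega>. \<forall>s\<le>t. \<omega> s \<in> V}"
  have "{\<omega> \<in> space law. \<forall>s\<in>{..t}. \<omega> s \<in> V} \<in> events" 
    by measurable
  then have S: "?S \<in> events"
    by (simp add: Ball_def)
  have "{\<omega> \<in> space law. (\<forall>s\<in>{..t}. \<omega> s \<in> V) \<and> (\<exists>x\<in>V. \<forall>s\<in>{..<t}. \<omega> s \<noteq> x)} \<in> events"
    using finite_V by measurable
  then have U: "uncovered t \<in> events"
    by (simp add: uncovered_def Ball_def Bex_def)
  have "{\<omega> \<in> space law. enat t < cover_time V \<omega>} \<subseteq> uncovered t \<union> (space law - ?S)"
  proof (rule subsetI)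
    fix \<omega> assume "\<omega> \<in> {\<omega> \<in> space law. enat t < cover_time V \<omega>}"
    then have "\<omega> ` {0..t} \<noteq> V"
      unfolding cover_time_def
      by (metis (mono_tags, lifting) Inf_lower leD mem_Collect_eq)
    then show "\<omega> \<in> uncovered t \<union> (space law - ?S)"
    proof (cases "\<omega> \<in> ?S")
      case True
      then have "\<not> V \<subseteq> \<omega> ` {0..t}"
        using \<open>\<omega> ` {0..t} \<noteq> V\<close> by auto
      then obtain x where "x \<in> V" "x \<notin> \<omega> ` {0..t}"
        by blast
      then have "\<forall>s<t. \<omega> s \<noteq> x"
        by (auto simp: image_iff)
      then show ?thesis
        using True \<open>x \<in> V\<close> by (auto simp: uncovered_def)
    qed simp
  qed
  then have "prob {\<omega> \<in> space law. enat t < cover_time V \<omega>} \<le> prob (uncovered t \<union> (space law - ?S))"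
    using U sets.compl_sets[OF S] by (intro finite_measure_mono sets.Un)
  also have "\<dots> \<le> prob (uncovered t) + prob (space law - ?S)"
    using U sets.compl_sets[OF S] by (intro measure_Un_le)
  also have "prob (space law - ?S) = 0"
    using prob_compl[OF S] prob_stays_in_V by simp
  finally show ?thesis
    by (simp add: lazy_walk_law_def)
qed


lemma event_staying_in_V:
  assumes "z \<in> V" and "Measurable.pred (walk z) Q"
  shows "{\<omega>. (\<forall>s\<le>t. \<omega> s \<in> V) \<and> Q \<omega>} \<in> sets (walk z)"
proof -
  interpret finite_chain V "lazy_kernel E \<mu>" z
    using \<open>z \<in> V\<close> by (rule finite_chain_lazy)
  have [measurable]: "Measurable.pred law Q"
    using assms(2) by (simp add: lazy_walk_law_def)
  have "{\<omega> \<in> space law. (\<forall>s\<in>{..t}. \<omega> s \<in> V) \<and> Q \<omega>} \<in> events"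
    by measurable
  then show ?thesis
    by (simp add: Ball_def lazy_walk_law_def)
qed

lemma measurable_occupation:
  assumes "z \<in> V" shows "(\<lambda>\<omega>. \<Sum>s<t. A (\<omega> s) :: real) \<in> borel_measurable (walk z)"
proof -
  interpret finite_chain V "lazy_kernel E \<mu>" z
    using \<open>z \<in> V\<close> by (rule finite_chain_lazy)
  show ?thesis
    unfolding lazy_walk_law_def by measurable
qed

lemma deviation_event:
  assumes "z \<in> V"
  shows "{\<omega>. (\<forall>s\<le>t. \<omega> s \<in> V) \<and> b \<le> (\<Sum>s<t. B (\<omega> s) :: real) \<and> (\<Sum>s<t. A (\<omega> s)) \<le> (a::real)} \<in> sets (walk z)"
  using measurable_occupation[OF assms, of B t, measurable] measurable_occupation[OF assms, of A t, measurable]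
  by (intro event_staying_in_V assms) measurable

text \<open>
  An unvisited vertex $x$ has zero occupation of $p_0(x,\cdot)$, so this is the deviation bound with
  source $A$ a multiple of $p_0(x,\cdot)$, summed over $x$.
\<close>

lemma prob_uncovered_le:
  fixes g B :: "'a \<Rightarrow> 'a \<Rightarrow> real"
  assumes z: "z \<in> V" and "0 < G" and "0 \<le> b" and "0 \<le> c"
    and B: "\<And>x w. x \<in> V \<Longrightarrow> w \<in> V \<Longrightarrow> 0 \<le> B x w"
    and g: "\<And>x w. x \<in> V \<Longrightarrow> w \<in> V \<Longrightarrow> 0 \<le> g x w \<and> g x w \<le> G"
    and poisson: "\<And>x w. x \<in> V \<Longrightarrow> w \<in> V \<Longrightarrow>
      g x w - (\<Sum>y\<in>V. P w y * g x y) = c * heat 0 x w - B x w"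
  shows "measure (walk z) {\<omega> \<in> uncovered t. \<forall>x\<in>V. b \<le> (\<Sum>s<t. B x (\<omega> s))}
    \<le> card V * (2 * exp (- b / (8 * G)))"
proof -
  interpret prob_space "walk z" by (rule prob_space_walk)
  let ?N = "\<lambda>x. {\<omega>. (\<forall>s\<le>t. \<omega> s \<in> V) \<and> b \<le> (\<Sum>s<t. B x (\<omega> s)) \<and> (\<Sum>s<t. c * heat 0 x (\<omega> s)) \<le> b / 4}"
  have "{\<omega> \<in> uncovered t. \<forall>x\<in>V. b \<le> (\<Sum>s<t. B x (\<omega> s))} \<subseteq> (\<Union>x\<in>V. ?N x)"
  proof
    fix \<omega> assume \<omega>: "\<omega> \<in> {\<omega> \<in> uncovered t. \<forall>x\<in>V. b \<le> (\<Sum>s<t. B x (\<omega> s))}"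
    then obtain x where x: "x \<in> V" "\<forall>s<t. \<omega> s \<noteq> x"
      by (auto simp: uncovered_def)
    then have "(\<Sum>s<t. c * heat 0 x (\<omega> s)) = 0"
      by (intro sum.neutral) (auto simp: heat.simps)
    then have "\<omega> \<in> ?N x"
      using \<omega> x \<open>0 \<le> b\<close> by (simp add: uncovered_def)
    with x show "\<omega> \<in> (\<Union>x\<in>V. ?N x)" by blast
  qed
  then have "measure (walk z) {\<omega> \<in> uncovered t. \<forall>x\<in>V. b \<le> (\<Sum>s<t. B x (\<omega> s))} \<le> measure (walk z) (\<Union>x\<in>V. ?N x)"
    by (intro finite_measure_mono sets.finite_UN finite_V deviation_event z)
  also have "\<dots> \<le> (\<Sum>x\<in>V. measure (walk z) (?N x))"
    by (intro finite_measure_subadditive_finite finite_V image_subsetI deviation_event z)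
  also have "\<dots> \<le> (\<Sum>x\<in>V. 2 * exp (- b / (8 * G)))"
    using heat_nonneg[of 0] \<open>0 \<le> c\<close>
    by (intro sum_mono occupation_deviation[OF z \<open>0 < G\<close> _ B g poisson]) auto
  finally show ?thesis by simp
qed

abbreviation local_time :: "nat \<Rightarrow> nat \<Rightarrow> 'a \<Rightarrow> (nat \<Rightarrow> 'a) \<Rightarrow> real" where
  "local_time n t x \<omega> \<equiv> (\<Sum>s<t. heat2 n x (\<omega> s))"

lemma heat2_sum_poisson:
  assumes "S \<le> T"
  shows "(\<Sum>i\<in>{S..<T}. heat2 i x z) - (\<Sum>y\<in>V. P z y * (\<Sum>i\<in>{S..<T}. heat2 i x y)) = heat2 S x z - heat2 T x z"
proof -
  have *: "(\<Sum>i\<in>{S..<T}. heat2 i x y) = (\<Sum>i\<in>{S..<T}. heat i x y) + (\<Sum>i\<in>{Suc S..<Suc T}. heat i x y)" for y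
    unfolding heat2_def sum.distrib sum.shift_bounds_Suc_ivl ..
  show ?thesis
    using heat_sum_poisson[OF assms, of x z] heat_sum_poisson[of "Suc S" "Suc T" x z] assms
    unfolding * by (simp add: heat2_def distrib_left sum.distrib del: sum.op_ivl_Suc)
qed

text \<open>
  One step from a coarse scale $k$ down to a finer one. A vertex $x$ with small local time at time $n'$
  makes all vertices of $W(x)$ have small local time at the earlier time $n$, by the Harnack-type
  hypothesis, and the deviation bound between $n$ and $k$ applies to each of these vertices.
\<close>

lemma prob_local_time_drop_le:
  assumes z: "z \<in> V" and "0 < G" and "0 < M" and "0 < v" and "n \<le> k"
    and W: "\<And>x. x \<in> V \<Longrightarrow> W x \<subseteq> V \<and> v \<le> sum m (W x)"
    and harnack: "\<And>x y w. x \<in> V \<Longrightarrow> y \<in> W x \<Longrightarrow> w \<in> V \<Longrightarrow> heat2 n y w \<le> M * heat2 n' x w"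
    and G: "\<And>x w. x \<in> V \<Longrightarrow> w \<in> V \<Longrightarrow> (\<Sum>i\<in>{n..<k}. heat2 i x w) \<le> G"
  shows "measure (walk z) {\<omega>. (\<forall>s\<le>t. \<omega> s \<in> V) \<and> (\<forall>x\<in>V. b \<le> local_time k t x \<omega>)
      \<and> (\<exists>x\<in>V. local_time n' t x \<omega> < b / (4 * M))} \<le> sum m V * (2 * exp (- b / (8 * G))) / v"
proof -
  interpret prob_space "walk z" by (rule prob_space_walk)
  let ?N = "\<lambda>y. {\<omega>. (\<forall>s\<le>t. \<omega> s \<in> V) \<and> b \<le> local_time k t y \<omega> \<and> local_time n t y \<omega> \<le> b / 4}"
  show ?thesis
  proof (rule prob_le_of_large_weight[where N = ?N])
    fix \<omega> assume \<omega>: "\<omega> \<in> {\<omega>. (\<forall>s\<le>t. \<omega> s \<in> V) \<and> (\<forall>x\<in>V. b \<le> local_time k t x \<omega>)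
      \<and> (\<exists>x\<in>V. local_time n' t x \<omega> < b / (4 * M))}"
    then obtain x where x: "x \<in> V" "local_time n' t x \<omega> < b / (4 * M)"
      by blast
    have "\<omega> \<in> ?N y" if y: "y \<in> W x" for y
    proof -
      have "local_time n t y \<omega> \<le> (\<Sum>s<t. M * heat2 n' x (\<omega> s))"
        using \<omega> x y by (intro sum_mono harnack) auto
      also have "\<dots> = M * local_time n' t x \<omega>"
        by (simp add: sum_distrib_left)
      also have "\<dots> \<le> M * (b / (4 * M))"
        using x \<open>0 < M\<close> by (intro mult_left_mono) auto
      finally have "local_time n t y \<omega> \<le> b / 4"
        using \<open>0 < M\<close> by simp
      then show ?thesis
        using \<omega> y W[OF x(1)] by auto
    qed
    moreover have "\<omega> \<in> space (walk z)"
      using finite_chain.space_law[OF finite_chain_lazy[OF z]] by (simp add: lazy_walk_law_def)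
    ultimately show "\<omega> \<in> space (walk z) \<and> (\<exists>W\<subseteq>V. v \<le> sum m W \<and> (\<forall>y\<in>W. \<omega> \<in> ?N y))"
      using W[OF x(1)] by blast
  next
    fix y assume y: "y \<in> V"
    show "?N y \<in> events"
      by (rule deviation_event[OF z])
    show "prob (?N y) \<le> 2 * exp (- b / (8 * G))"
      using y G heat2_nonneg
      by (intro occupation_deviation[OF z \<open>0 < G\<close>, where g = "\<lambda>w. \<Sum>i\<in>{n..<k}. heat2 i y w"])
        (auto intro: sum_nonneg heat2_sum_poisson[OF \<open>n \<le> k\<close>])
  qed (use finite_V m_nonneg \<open>0 < v\<close> in auto)
qed

text \<open>
  Chaining over the scales $k_0, \dots, k_J$: if the graph is not covered, then either the finest local
  times are all large and a vertex is missed nevertheless, or there is a first scale from below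
  at which all local times are large, and the step from it to the next finer scale fails. At the bottom
  the source is $2 p_0 - \hat p_{k_0}$, whose potential is the sum of the heat kernels up to $k_0 - 1$ and
  up to $k_0$.
\<close>

lemma prob_uncovered_le_cascade:
  fixes b :: "nat \<Rightarrow> real"
  assumes z: "z \<in> V" and "0 < G" and "0 \<le> b 0"
    and bottom: "\<And>x w. x \<in> V \<Longrightarrow> w \<in> V \<Longrightarrow> 2 * (\<Sum>i\<le>k 0. heat i x w) \<le> G"
    and top: "\<And>x \<omega>. x \<in> V \<Longrightarrow> (\<And>s. s \<le> t \<Longrightarrow> \<omega> s \<in> V) \<Longrightarrow> b J \<le> local_time (k J) t x \<omega>"
    and step: "\<And>j. j < J \<Longrightarrow> measure (walk z) {\<omega>. (\<forall>s\<le>t. \<omega> s \<in> V) \<and>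
        (\<forall>x\<in>V. b (Suc j) \<le> local_time (k (Suc j)) t x \<omega>) \<and> (\<exists>x\<in>V. local_time (k j) t x \<omega> < b j)} \<le> \<epsilon> j"
  shows "measure (walk z) (uncovered t) \<le> card V * (2 * exp (- b 0 / (8 * G))) + sum \<epsilon> {..<J}"
proof -
  interpret prob_space "walk z" by (rule prob_space_walk)
  let ?G = "\<lambda>j. {\<omega>. (\<forall>x\<in>V. b j \<le> local_time (k j) t x \<omega>)}"
  let ?S = "{\<omega>. \<forall>s\<le>t. \<omega> s \<in> V}"
  let ?D = "\<lambda>j. {\<omega>. (\<forall>s\<le>t. \<omega> s \<in> V) \<and>
        (\<forall>x\<in>V. b (Suc j) \<le> local_time (k (Suc j)) t x \<omega>) \<and> (\<exists>x\<in>V. local_time (k j) t x \<omega> < b j)}"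
  let ?U = "{\<omega> \<in> uncovered t. \<forall>x\<in>V. b 0 \<le> local_time (k 0) t x \<omega>}"
  have D: "?D j \<in> events" for j
    using measurable_occupation[OF z, measurable] finite_V by (intro event_staying_in_V z) measurable
  have Ueq: "?U = {\<omega>. (\<forall>s\<le>t. \<omega> s \<in> V) \<and> (\<exists>x\<in>V. \<forall>s\<in>{..<t}. \<omega> s \<noteq> x) \<and> (\<forall>x\<in>V. b 0 \<le> local_time (k 0) t x \<omega>)}"
    by (auto simp: uncovered_def)
  have U: "?U \<in> events"
  proof -
    interpret C: finite_chain V "lazy_kernel E \<mu>" z
      using z by (rule finite_chain_lazy)
    have "Measurable.pred C.law (\<lambda>\<omega>. \<exists>x\<in>V. \<forall>s\<in>{..<t}. \<omega> s \<noteq> x)"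
      using finite_V by measurable
    then have [measurable]: "Measurable.pred (walk z) (\<lambda>\<omega>. \<exists>x\<in>V. \<forall>s\<in>{..<t}. \<omega> s \<noteq> x)"
      by (simp add: lazy_walk_law_def)
    show ?thesis
      unfolding Ueq using measurable_occupation[OF z, measurable] finite_V
      by (intro event_staying_in_V z) measurable
  qed
  have "uncovered t \<subseteq> ?U \<union> (\<Union>j\<in>{..<J}. ?D j)"
  proof
    fix \<omega> assume \<omega>: "\<omega> \<in> uncovered t"
    then have S: "\<omega> \<in> ?S" by (simp add: uncovered_def)
    then have GJ: "\<omega> \<in> ?G J" using top by auto
    define j where "j = (LEAST j. \<omega> \<in> ?G j)"
    have j: "\<omega> \<in> ?G j" "j \<le> J"
      using LeastI[of "\<lambda>j. \<omega> \<in> ?G j", OF GJ] Least_le[of "\<lambda>j. \<omega> \<in> ?G j", OF GJ]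
      unfolding j_def by blast+
    show "\<omega> \<in> ?U \<union> (\<Union>j\<in>{..<J}. ?D j)"
    proof (cases j)
      case 0
      then show ?thesis using \<omega> j by auto
    next
      case (Suc i)
      have "i < j" by (simp add: Suc)
      then have "\<omega> \<notin> ?G i"
        unfolding j_def by (rule not_less_Least)
      then have "\<exists>x\<in>V. local_time (k i) t x \<omega> < b i"
        by (auto simp: not_le)
      moreover have "\<forall>x\<in>V. b (Suc i) \<le> local_time (k (Suc i)) t x \<omega>"
        using j(1) unfolding Suc by simp
      ultimately have "\<omega> \<in> ?D i"
        using S by blast
      moreover have "i < J"
        using \<open>i < j\<close> j(2) by simp
      ultimately show ?thesis by blast
    qed
  qed
  then have "prob (uncovered t) \<le> prob (?U \<union> (\<Union>j\<in>{..<J}. ?D j))"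
    using U D by (intro finite_measure_mono) auto
  also have "\<dots> \<le> prob ?U + prob (\<Union>j\<in>{..<J}. ?D j)"
    using U D by (intro measure_Un_le) auto
  also have "prob (\<Union>j\<in>{..<J}. ?D j) \<le> (\<Sum>j<J. prob (?D j))"
    using D by (intro finite_measure_subadditive_finite) auto
  also have "\<dots> \<le> sum \<epsilon> {..<J}"
    using step by (intro sum_mono) simp
  also have "prob ?U \<le> card V * (2 * exp (- b 0 / (8 * G)))"
  proof (rule prob_uncovered_le[OF z \<open>0 < G\<close> \<open>0 \<le> b 0\<close>, where c = 2])
    fix x w assume x: "x \<in> V" and w: "w \<in> V"
    let ?g = "\<lambda>w. (\<Sum>i\<in>{0..<k 0}. heat i x w) + (\<Sum>i\<in>{0..<Suc (k 0)}. heat i x w)"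
    show "?g w - (\<Sum>y\<in>V. P w y * ?g y) = 2 * heat 0 x w - heat2 (k 0) x w"
      using heat_sum_poisson[of 0 "k 0" x w] heat_sum_poisson[of 0 "Suc (k 0)" x w]
      by (simp add: distrib_left sum.distrib heat2_def del: sum.op_ivl_Suc)
    have "(\<Sum>i\<in>{0..<k 0}. heat i x w) \<le> (\<Sum>i\<le>k 0. heat i x w)"
      by (intro sum_mono2) (auto simp: heat_nonneg)
    moreover have "(\<Sum>i\<in>{0..<Suc (k 0)}. heat i x w) = (\<Sum>i\<le>k 0. heat i x w)"
      by (intro sum.cong) auto
    ultimately show "0 \<le> ?g w \<and> ?g w \<le> G"
      using bottom[OF x w] by (auto intro!: add_nonneg_nonneg sum_nonneg heat_nonneg)
  qed (simp_all add: heat2_nonneg)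
  finally show ?thesis by simp
qed


section \<open>Distances, and exponential tails on a single graph\<close>

lemma relpow_in_V: "(x, y) \<in> edge_rel E ^^ n \<Longrightarrow> x \<in> V \<Longrightarrow> y \<in> V"
  by (induction n arbitrary: y) (auto simp: edge_rel_def dest: edge_in_V)

lemma gdist_path: "x \<in> V \<Longrightarrow> y \<in> V \<Longrightarrow> (x, y) \<in> edge_rel E ^^ gdist E x y"
  unfolding gdist_def using connected[of x y] by (metis (mono_tags, lifting) LeastI rtrancl_power)

lemma gdist_le: "(x, y) \<in> edge_rel E ^^ n \<Longrightarrow> gdist E x y \<le> n"
  unfolding gdist_def by (rule Least_le)

lemma gdist_refl [simp]: "gdist E x x = 0"
  using gdist_le[of x x 0] by simp

lemma gdist_eq_0: "x \<in> V \<Longrightarrow> y \<in> V \<Longrightarrow> gdist E x y = 0 \<Longrightarrow> y = x"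
  using gdist_path[of x y] by simp

lemma gdist_intermediate:
  assumes "x \<in> V" "y \<in> V" "gdist E x y \<le> a + b"
  shows "\<exists>w\<in>V. gdist E x w \<le> a \<and> gdist E w y \<le> b"
proof (cases "gdist E x y \<le> a")
  case True
  then show ?thesis using assms by (intro bexI[of _ y]) auto
next
  case False
  then have "(x, y) \<in> edge_rel E ^^ a O edge_rel E ^^ (gdist E x y - a)"
    using gdist_path[OF assms(1,2)] by (simp add: relpow_add[symmetric])
  then obtain w where w: "(x, w) \<in> edge_rel E ^^ a" "(w, y) \<in> edge_rel E ^^ (gdist E x y - a)"
    by blast
  then show ?thesis
    using relpow_in_V[OF w(1) assms(1)] gdist_le[OF w(1)] gdist_le[OF w(2)] assms(3)
    by (intro bexI[of _ w]) auto
qed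

lemma gdist_le_gdiam: "x \<in> V \<Longrightarrow> y \<in> V \<Longrightarrow> gdist E x y \<le> gdiam V E"
proof -
  assume xy: "x \<in> V" "y \<in> V"
  have "{gdist E x y | x y. x \<in> V \<and> y \<in> V} = (\<lambda>(x, y). gdist E x y) ` (V \<times> V)"
    by auto
  then have "finite {gdist E x y | x y. x \<in> V \<and> y \<in> V}"
    using finite_V by simp
  then show ?thesis
    unfolding gdiam_def using xy by (intro Max_ge) auto
qed

lemma gdiam_pos: "0 < gdiam V E"
proof -
  obtain x where "x \<in> V" using card_V by fastforce
  then obtain y where "{x, y} \<in> E" using exists_neighbour by blast
  then have "y \<in> V" "y \<noteq> x" using edge_in_V by auto
  then have "gdist E x y \<noteq> 0" using gdist_eq_0 \<open>x \<in> V\<close> by blast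
  then show ?thesis
    using gdist_le_gdiam[OF \<open>x \<in> V\<close> \<open>y \<in> V\<close>] by simp
qed

lemma gball_subset: "gball V E x r \<subseteq> V"
  by (auto simp: gball_def)

lemma gball_gdiam: "x \<in> V \<Longrightarrow> gball V E x (gdiam V E) = V"
  using gdist_le_gdiam by (auto simp: gball_def)

lemma heat_pos: "(x, z) \<in> edge_rel E ^^ n \<Longrightarrow> x \<in> V \<Longrightarrow> 0 < heat n x z"
proof (induction n arbitrary: z)
  case 0
  then show ?case using m_pos by (simp add: heat.simps)
next
  case (Suc n)
  then obtain y where y: "(x, y) \<in> edge_rel E ^^ n" "{y, z} \<in> E"
    by (auto simp: edge_rel_def)
  then have V: "y \<in> V" "z \<in> V" using edge_in_V by auto
  have "0 < P z y"
    using y V m_pos mu_pos_iff[of z y] by (simp add: transition_def insert_commute)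
  then have "0 < P z y * heat n x y"
    using Suc.IH[OF y(1) Suc.prems(2)] by simp
  also have "\<dots> \<le> (\<Sum>y\<in>V. P z y * heat n x y)"
    using V finite_V by (intro member_le_sum) (auto intro!: mult_nonneg_nonneg simp: P_nonneg heat_nonneg)
  finally show ?case by (simp add: heat.simps)
qed

text \<open>
  Here $\sum_{k\le n} p_k$ with $n$ the diameter serves as the coarse kernel: it is positive everywhere by
  connectedness, whatever the parity, and
  $(n+1) p_0 - \sum_{k\le n} p_k$ is the source of $\sum_{k\le n} \sum_{i<k} p_i$.
\<close>

lemma cover_time_tail_exponential:
  "\<exists>c>0. \<forall>z\<in>V. \<forall>t. measure (walk z) {\<omega> \<in> space (walk z). enat t < cover_time V \<omega>}
     \<le> c * exp (- real t / c)"
proof -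
  define n where "n = gdiam V E"
  define B where "B x w = (\<Sum>k\<le>n. heat k x w)" for x w
  define g where "g x w = (\<Sum>k\<le>n. \<Sum>i\<in>{0..<k}. heat i x w)" for x w
  define \<beta> where "\<beta> = Min ((\<lambda>(x, w). B x w) ` (V \<times> V))"
  define G where "G = Max ((\<lambda>(x, w). g x w) ` (V \<times> V)) + 1"
  have V: "V \<noteq> {}" using card_V by auto
  have B_pos: "0 < B x w" if "x \<in> V" "w \<in> V" for x w
  proof -
    have "0 < heat (gdist E x w) x w"
      using heat_pos gdist_path that by blast
    also have "\<dots> \<le> B x w"
      unfolding B_def n_def using gdist_le_gdiam[OF that] by (intro member_le_sum) (auto simp: heat_nonneg)
    finally show ?thesis .
  qed
  have "0 < \<beta>"
    unfolding \<beta>_def using B_pos V finite_V by (subst Min_gr_iff) auto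
  have \<beta>: "\<beta> \<le> B x w" if "x \<in> V" "w \<in> V" for x w
    unfolding \<beta>_def using that finite_V by (intro Min_le) auto
  have g: "0 \<le> g x w \<and> g x w \<le> G" if "x \<in> V" "w \<in> V" for x w
  proof -
    have "g x w \<le> Max ((\<lambda>(x, w). g x w) ` (V \<times> V))"
      using that finite_V by (intro Max_ge) auto
    moreover have "0 \<le> g x w"
      unfolding g_def by (intro sum_nonneg heat_nonneg)
    ultimately show ?thesis by (simp add: G_def)
  qed
  have "0 < G"
  proof -
    obtain x where "x \<in> V" using V by blast
    then have "g x x \<le> Max ((\<lambda>(x, w). g x w) ` (V \<times> V))"
      using finite_V by (intro Max_ge) auto
    moreover have "0 \<le> g x x"
      using g \<open>x \<in> V\<close> by blast
    ultimately show ?thesis by (simp add: G_def)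
  qed
  have poisson: "g x w - (\<Sum>y\<in>V. P w y * g x y) = (real n + 1) * heat 0 x w - B x w" for x w
  proof -
    have "(\<Sum>y\<in>V. P w y * g x y) = (\<Sum>k\<le>n. \<Sum>y\<in>V. P w y * (\<Sum>i\<in>{0..<k}. heat i x y))"
      unfolding g_def sum_distrib_left by (subst sum.swap) simp
    then have "g x w - (\<Sum>y\<in>V. P w y * g x y) = (\<Sum>k\<le>n. heat 0 x w - heat k x w)"
      unfolding g_def by (simp add: sum_subtractf[symmetric] heat_sum_poisson)
    then show ?thesis
      by (simp add: B_def sum_subtractf)
  qed
  have bound: "measure (walk z) (uncovered t) \<le> card V * (2 * exp (- (t * \<beta>) / (8 * G)))"
    if z: "z \<in> V" for z t
  proof -
    have "t * \<beta> \<le> (\<Sum>s<t. B x (\<omega> s))" if "x \<in> V" "\<And>s. s \<le> t \<Longrightarrow> \<omega> s \<in> V" for x \<omega>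
      using sum_bounded_below[of "{..<t}" \<beta> "\<lambda>s. B x (\<omega> s)"] \<beta> that by simp
    then have "uncovered t = {\<omega> \<in> uncovered t. \<forall>x\<in>V. t * \<beta> \<le> (\<Sum>s<t. B x (\<omega> s))}"
      by (auto simp: uncovered_def)
    with prob_uncovered_le[OF z \<open>0 < G\<close> _ _ _ g poisson, of "t * \<beta>" t] \<open>0 < \<beta>\<close> B_pos
    show ?thesis by (simp add: less_imp_le)
  qed
  define c where "c = 2 * card V + 8 * G / \<beta>"
  have c: "0 < c" "2 * card V \<le> c" "8 * G / \<beta> \<le> c" "0 < 8 * G / \<beta>"
    using \<open>0 < G\<close> \<open>0 < \<beta>\<close> by (auto simp: c_def add_nonneg_pos)
  have "measure (walk z) {\<omega> \<in> space (walk z). enat t < cover_time V \<omega>} \<le> c * exp (- real t / c)"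
    if "z \<in> V" for z t
  proof -
    have "measure (walk z) {\<omega> \<in> space (walk z). enat t < cover_time V \<omega>} \<le> measure (walk z) (uncovered t)"
      by (rule cover_time_tail_le_uncovered[OF that])
    also have "\<dots> \<le> 2 * card V * exp (- (t / (8 * G / \<beta>)))"
      using bound[OF that, of t] by (simp add: mult.commute)
    also have "\<dots> \<le> c * exp (- (t / c))"
    proof (intro mult_mono)
      show "exp (- (t / (8 * G / \<beta>))) \<le> exp (- (t / c))"
        using c by (intro exp_mono le_imp_neg_le divide_left_mono mult_pos_pos) auto
    qed (use c in auto)
    finally show ?thesis by simp
  qed
  with c(1) show ?thesis by blast
qed

section \<open>Consequences of the parabolic Harnack inequality\<close>

text \<open>
  Both summands of $\hat p_n$ have times in $[n, 2n]$, which accounts for the factor $2$. The constant of the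
  Harnack inequality may be negative, hence its replacement by a nonnegative upper bound.
\<close>

lemma heat2_harnack:
  assumes x: "x \<in> V" and "0 < n" and z: "z \<in> gball V E x0 R" and z': "z' \<in> gball V E x0 R"
    and harnack: "\<And>u. (\<forall>t. \<forall>x\<in>V. 0 \<le> u t x) \<and> caloric_on V E \<mu> (4 * real n) (gball V E x0 (2 * R)) u \<Longrightarrow>
        Max {u s z | s z. z \<in> gball V E x0 R \<and> real n \<le> real s \<and> real s \<le> 2 * real n}
        \<le> C * Min {u s z + u (Suc s) z | s z. z \<in> gball V E x0 R \<and> 3 * real n \<le> real s \<and> real s \<le> 4 * real n}"
    and C: "C \<le> C'" "0 \<le> C'"
  shows "heat2 n x z \<le> 2 * C' * heat2 (3 * n) x z'"
proof -
  let ?B = "gball V E x0 R"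
  let ?A = "{heat s x z | s z. z \<in> ?B \<and> real n \<le> real s \<and> real s \<le> 2 * real n}"
  let ?D = "{heat s x z + heat (Suc s) x z | s z. z \<in> ?B \<and> 3 * real n \<le> real s \<and> real s \<le> 4 * real n}"
  have finB: "finite ?B" using finite_subset[OF gball_subset finite_V] .
  have "?A \<subseteq> (\<lambda>(s, z). heat s x z) ` ({..2 * n} \<times> ?B)"
    by (auto simp: image_iff)
  then have finA: "finite ?A"
    by (rule finite_subset) (intro finite_imageI finite_cartesian_product finB finite_atMost)
  have "?D \<subseteq> (\<lambda>(s, z). heat s x z + heat (Suc s) x z) ` ({..4 * n} \<times> ?B)"
    by (auto simp: image_iff)
  then have finD: "finite ?D"
    by (rule finite_subset) (intro finite_imageI finite_cartesian_product finB finite_atMost)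
  have z'D: "heat2 (3 * n) x z' \<in> ?D"
    using z' unfolding heat2_def by (intro CollectI exI[of _ "3 * n"] exI[of _ z']) auto
  then have "Min ?D \<in> ?D"
    using finD by (intro Min_in) auto
  then have Min_nonneg: "0 \<le> Min ?D"
    by (auto intro!: add_nonneg_nonneg heat_nonneg)
  have "caloric_on V E \<mu> (4 * real n) (gball V E x0 (2 * R)) (\<lambda>s. heat s x)"
    by (simp add: caloric_on_def heat.simps)
  then have "Max ?A \<le> C * Min ?D"
    by (intro harnack) (simp add: heat_nonneg)
  also have "\<dots> \<le> C' * Min ?D"
    using C Min_nonneg by (intro mult_right_mono)
  also have "\<dots> \<le> C' * heat2 (3 * n) x z'"
    using C Min_le[OF finD z'D] by (intro mult_left_mono)
  finally have "Max ?A \<le> C' * heat2 (3 * n) x z'" .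
  moreover have "heat n x z \<le> Max ?A" "heat (Suc n) x z \<le> Max ?A"
  proof -
    show "heat n x z \<le> Max ?A"
      using z by (intro Max_ge finA CollectI exI[of _ n] exI[of _ z]) auto
    show "heat (Suc n) x z \<le> Max ?A"
      using z \<open>0 < n\<close> by (intro Max_ge finA CollectI exI[of _ "Suc n"] exI[of _ z]) auto
  qed
  ultimately show ?thesis
    by (simp add: heat2_def)
qed

end

text \<open>
  What the uniform hypotheses say about one graph of large diameter, with all constants as
  parameters so that bounds in terms of them are uniform over a family. The number $K$ is large enough
  for $K$ balls of radius $\lfloor c_P D \rfloor$ to form a chain across the graph; each link
  multiplies time by $3$, hence the range $3^{K+1} R^{d_w}$ of times.
\<close>

locale harnack_graph = weighted_graph V E \<mu>
  for V :: "'a set" and E :: "'a set set" and \<mu> :: "'a \<Rightarrow> 'a \<Rightarrow> real" +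
  fixes d\<^sub>f d\<^sub>w c\<^sub>P c\<^sub>e c\<^sub>v M :: real and K :: nat
  assumes exponents: "0 < d\<^sub>f" "1 \<le> d\<^sub>w" "d\<^sub>f < d\<^sub>w"
    and constants: "0 < c\<^sub>P" "c\<^sub>P \<le> 1" "0 < c\<^sub>e" "0 < c\<^sub>v" "1 \<le> M" "2 \<le> c\<^sub>P * K"
    and large_diam: "1 \<le> c\<^sub>P * gdiam V E"
    and m_ge: "\<And>x. x \<in> V \<Longrightarrow> inverse c\<^sub>e \<le> m x"
    and volume: "\<And>x (r::real). x \<in> V \<Longrightarrow> 1 \<le> r \<Longrightarrow> r \<le> gdiam V E \<Longrightarrow>
      inverse c\<^sub>v * r powr d\<^sub>f \<le> sum m (gball V E x r) \<and> sum m (gball V E x r) \<le> c\<^sub>v * r powr d\<^sub>f"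
    and harnack: "\<And>x x0 z z' n R. x \<in> V \<Longrightarrow> x0 \<in> V \<Longrightarrow> z \<in> gball V E x0 R \<Longrightarrow> z' \<in> gball V E x0 R \<Longrightarrow>
      1 \<le> R \<Longrightarrow> R \<le> c\<^sub>P * gdiam V E \<Longrightarrow> 2 * R powr d\<^sub>w \<le> real n \<Longrightarrow> real n \<le> 3 ^ Suc K * R powr d\<^sub>w \<Longrightarrow>
      heat2 n x z \<le> M * heat2 (3 * n) x z'"
begin

abbreviation D :: real where "D \<equiv> real (gdiam V E)"

lemma D_ge_1: "1 \<le> D"
  using gdiam_pos by simp

lemma total_weight_le: "sum m V \<le> c\<^sub>v * D powr d\<^sub>f"
proof -
  obtain x where "x \<in> V" using card_V by fastforce
  then show ?thesis
    using volume[of x D] D_ge_1 gball_gdiam by simp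
qed

lemma total_weight_pos: "0 < sum m V"
  using card_V finite_V m_pos by (intro sum_pos) auto

lemma card_le: "card V \<le> c\<^sub>e * sum m V"
proof -
  have "card V * inverse c\<^sub>e \<le> sum m V"
    using sum_bounded_below[of V "inverse c\<^sub>e" m] m_ge by simp
  then show ?thesis using constants by (simp add: field_simps)
qed

lemma heat_le: "x \<in> V \<Longrightarrow> w \<in> V \<Longrightarrow> heat n x w \<le> c\<^sub>e"
proof (rule heat_le_later[of 0])
  fix y assume "x \<in> V" "y \<in> V"
  then show "heat 0 x y \<le> c\<^sub>e"
    using m_ge[of x] m_pos[of x] constants by (auto simp: heat.simps field_simps)
qed auto

text \<open>
  Decay of the kernel, uniform in both vertices: by the Harnack inequality the value at $w$ is dominated by the values in a ball
  of radius $R$ at a later time, and these have total mass at most $2$.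
\<close>

lemma heat2_le:
  assumes x: "x \<in> V" and w: "w \<in> V" and R: "1 \<le> R" "R \<le> c\<^sub>P * D"
    and n: "2 * R powr d\<^sub>w \<le> real n" "real n \<le> 3 ^ Suc K * R powr d\<^sub>w" and "n \<le> k"
  shows "heat2 k x w \<le> 4 * M * c\<^sub>v * R powr (- d\<^sub>f)"
proof -
  have RD: "R \<le> D"
    using R constants D_ge_1 by (meson mult_left_le_one_le of_nat_0_le_iff order_trans less_imp_le)
  have n_bound: "heat n x z \<le> 2 * M * c\<^sub>v * R powr (- d\<^sub>f)" if z: "z \<in> V" for z
  proof -
    let ?B = "gball V E z R"
    have "heat n x z * (inverse c\<^sub>v * R powr d\<^sub>f) \<le> heat n x z * sum m ?B"
      using volume[OF z R(1) RD] by (intro mult_left_mono heat_nonneg) simp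
    also have "\<dots> = (\<Sum>y\<in>?B. m y * heat n x z)"
      by (simp add: sum_distrib_left mult.commute)
    also have "\<dots> \<le> (\<Sum>y\<in>?B. m y * (M * heat2 (3 * n) x y))"
    proof (intro sum_mono mult_left_mono m_nonneg)
      fix y assume y: "y \<in> ?B"
      have "heat n x z \<le> heat2 n x z"
        by (simp add: heat2_def heat_nonneg)
      also have "\<dots> \<le> M * heat2 (3 * n) x y"
        by (rule harnack[OF x z _ y R n]) (use z R in \<open>simp add: gball_def\<close>)
      finally show "heat n x z \<le> M * heat2 (3 * n) x y" .
    qed
    also have "\<dots> \<le> (\<Sum>y\<in>V. m y * (M * heat2 (3 * n) x y))"
      using constants
      by (intro sum_mono2 finite_V gball_subset mult_nonneg_nonneg m_nonneg heat2_nonneg) simp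
    also have "\<dots> = M * 2"
      using heat2_mass[OF x, of "3 * n"] by (simp add: mult.left_commute sum_distrib_left[symmetric])
    finally show ?thesis
      using R constants by (simp add: powr_minus field_simps)
  qed
  have "heat k x w \<le> 2 * M * c\<^sub>v * R powr (- d\<^sub>f)" "heat (Suc k) x w \<le> 2 * M * c\<^sub>v * R powr (- d\<^sub>f)"
    using heat_le_later[OF n_bound] \<open>n \<le> k\<close> w by auto
  then show ?thesis by (simp add: heat2_def)
qed

definition top_time :: nat where
  "top_time = 3 ^ K * nat \<lceil>2 * (c\<^sub>P * D) powr d\<^sub>w\<rceil>"

lemma scale_ge_1: "1 \<le> (c\<^sub>P * D) powr d\<^sub>w"
  using large_diam exponents by (simp add: ge_one_powr_ge_zero)

lemma top_time_bounds:
  "2 * (c\<^sub>P * D) powr d\<^sub>w \<le> top_time" "top_time \<le> 3 ^ Suc K * (c\<^sub>P * D) powr d\<^sub>w"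
proof -
  let ?n = "nat \<lceil>2 * (c\<^sub>P * D) powr d\<^sub>w\<rceil>"
  have n: "2 * (c\<^sub>P * D) powr d\<^sub>w \<le> ?n" "?n \<le> 3 * (c\<^sub>P * D) powr d\<^sub>w"
    using scale_ge_1 by linarith+
  have "1 * real ?n \<le> 3 ^ K * real ?n"
    by (intro mult_right_mono of_nat_0_le_iff) simp
  then show "2 * (c\<^sub>P * D) powr d\<^sub>w \<le> top_time"
    using n(1) unfolding top_time_def of_nat_mult of_nat_power of_nat_numeral by linarith
  have "3 ^ K * real ?n \<le> 3 ^ K * (3 * (c\<^sub>P * D) powr d\<^sub>w)"
    using n(2) by (intro mult_left_mono) auto
  then show "top_time \<le> 3 ^ Suc K * (c\<^sub>P * D) powr d\<^sub>w"
    unfolding top_time_def of_nat_mult of_nat_power of_nat_numeral by (simp only: power_Suc mult_ac)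
qed

text \<open>
  Some vertex carries at least the average of $\hat p$; this lower bound is then transported to $w$ through
  $K$ overlapping balls.
\<close>

lemma heat2_top_time_ge:
  assumes x: "x \<in> V" and w: "w \<in> V"
  shows "2 / (M ^ K * sum m V) \<le> heat2 top_time x w"
proof -
  define R where "R = c\<^sub>P * D"
  define n where "n = nat \<lceil>2 * R powr d\<^sub>w\<rceil>"
  define r where "r = nat \<lfloor>R\<rfloor>"
  have R1: "1 \<le> R" using large_diam by (simp add: R_def)
  have n: "2 * R powr d\<^sub>w \<le> n" "n \<le> 3 * R powr d\<^sub>w"
    using scale_ge_1 unfolding n_def R_def by linarith+
  \<comment> \<open>\<open>heat2\<close> has total mass 2, so it attains at least its average.\<close>
  obtain z0 where z0: "z0 \<in> V" "2 / sum m V \<le> heat2 n x z0"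
  proof (rule ccontr)
    assume "\<not> thesis"
    then have "heat2 n x z < 2 / sum m V" if "z \<in> V" for z
      using that by (meson \<open>\<And>z0. \<lbrakk>z0 \<in> V; 2 / sum m V \<le> heat2 n x z0\<rbrakk> \<Longrightarrow> thesis\<close> not_le)
    then have "(\<Sum>z\<in>V. m z * heat2 n x z) < (\<Sum>z\<in>V. m z * (2 / sum m V))"
      using finite_V x m_pos by (intro sum_strict_mono mult_strict_left_mono) auto
    then show False
      using total_weight_pos heat2_mass[OF x] by (simp add: sum_distrib_right[symmetric] sum_divide_distrib[symmetric])
  qed
  have chain: "2 / (M ^ j * sum m V) \<le> heat2 (3 ^ j * n) x z"
    if "j \<le> K" "z \<in> V" "gdist E z0 z \<le> j * r" for j z
    using that
  proof (induction j arbitrary: z)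
    case 0
    then show ?case using z0 gdist_eq_0[of z0 z] by simp
  next
    case (Suc j)
    then obtain y where y: "y \<in> V" "gdist E z0 y \<le> j * r" "gdist E y z \<le> r"
      using gdist_intermediate[OF z0(1), of z "j * r" r] by (auto simp: add.commute)
    have "2 / (M ^ j * sum m V) \<le> heat2 (3 ^ j * n) x y"
      using Suc y by simp
    also have "\<dots> \<le> M * heat2 (3 * (3 ^ j * n)) x z"
    proof (rule harnack[where R = R and ?x0.0 = y])
      show "y \<in> gball V E y R" "z \<in> gball V E y R"
        using y Suc.prems R1 by (auto simp: gball_def r_def) linarith
      have "1 * real n \<le> 3 ^ j * real n"
        by (intro mult_right_mono) auto
      then show "2 * R powr d\<^sub>w \<le> real (3 ^ j * n)"
        using n(1) by simp
      have "3 ^ j * real n \<le> 3 ^ K * (3 * R powr d\<^sub>w)"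
        using n(2) Suc.prems by (intro mult_mono power_increasing) auto
      then show "real (3 ^ j * n) \<le> 3 ^ Suc K * R powr d\<^sub>w" by simp
    qed (use x y R1 in \<open>auto simp: R_def\<close>)
    finally show ?case
      using constants total_weight_pos by (simp add: field_simps)
  qed
  have "1 \<le> \<lfloor>R\<rfloor>"
    using R1 by simp
  then have "real r = of_int \<lfloor>R\<rfloor>" "(1::real) \<le> of_int \<lfloor>R\<rfloor>"
    unfolding r_def by simp_all
  then have "R / 2 \<le> r"
    using floor_correct[of R] by linarith
  then have "K * (R / 2) \<le> K * real r"
    by (intro mult_left_mono) auto
  moreover have "2 * D \<le> K * R"
    using mult_right_mono[OF constants(6), of D] by (simp add: R_def mult_ac)
  ultimately have "D \<le> real (K * r)" by simp
  then have "gdist E z0 w \<le> K * r"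
    using gdist_le_gdiam[OF z0(1) w] by linarith
  then show ?thesis
    using chain[of K w] w by (simp add: top_time_def n_def R_def)
qed

end

section \<open>Summing over the scales\<close>

lemma exists_power_bracket:
  fixes X :: real and a :: nat
  assumes "1 \<le> X" "2 \<le> a"
  obtains i where "real a ^ i \<le> X" "X < real a ^ Suc i"
proof -
  obtain n where n: "X < real a ^ n"
    using real_arch_pow[of "real a" X] assms by auto
  define j where "j = (LEAST n. X < real a ^ n)"
  have j: "X < real a ^ j"
    unfolding j_def by (rule LeastI[of _ n]) (rule n)
  then obtain i where i: "j = Suc i"
    using assms by (cases j) auto
  then have "\<not> X < real a ^ i"
    unfolding j_def by (intro not_less_Least) simp
  then show ?thesis
    using that[of i] j i by simp
qed

context harnack_graph
begin

text \<open>
  The cascade with scales $R_j = a^{j/d_w}$ and times $6 a^j$ for $j < J$, and with the top time as scale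
  $J$; here $a^J$ is comparable to $D^{d_w}$. The local time demanded at scale $j$ is
  $b_j = t \beta / (4M)^{J-j}$, and the potential between two scales is at most a constant times
  $B^j = R_j^{d_w - d_f}$, while $A^j = R_j^{d_f}$ is the volume of a ball. The condition $8M \le B$ makes
  the exponents $b_{j+1} / B^j$ grow like $2^{J-j}$, faster than the entropy $A^{J-j}$ of the union
  bound can compensate.
\<close>

lemma prob_uncovered_le_sum:
  fixes a :: nat and A B C \<kappa> :: real
  assumes z: "z \<in> V" and "2 \<le> a" and A: "A = a powr (d\<^sub>f / d\<^sub>w)" and B: "B = a powr (1 - d\<^sub>f / d\<^sub>w)"
    and a_large: "8 * M \<le> B"
    and C: "C = 2 * (c\<^sub>v + c\<^sub>e) * (c\<^sub>v * c\<^sub>P powr (- d\<^sub>f))"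
    and C3: "C3 = 4 * M * c\<^sub>v * ((6 + 3 ^ Suc K) * a) + 14 * c\<^sub>e"
    and \<kappa>: "\<kappa> = 1 / (8 * C3 * (M ^ K * c\<^sub>v) * B)"
  shows "\<exists>J. measure (walk z) (uncovered t)
    \<le> 2 * C * (\<Sum>i\<le>J. A ^ i * exp (- (\<kappa> * (t / D powr d\<^sub>w) * 2 ^ i)))"
proof -
  define \<theta> where "\<theta> = d\<^sub>f / d\<^sub>w"
  define s where "s = t / D powr d\<^sub>w"
  have \<theta>: "0 < \<theta>" "\<theta> < 1" using exponents by (auto simp: \<theta>_def)
  have dw: "0 < d\<^sub>w" and df: "d\<^sub>f = d\<^sub>w * \<theta>" using exponents by (auto simp: \<theta>_def)
  have a: "1 < real a" "0 < real a" using \<open>2 \<le> a\<close> by auto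
  have A1: "1 \<le> A" and AB: "A * B = a"
    using a \<theta> unfolding A B \<theta>_def[symmetric] by (auto simp: ge_one_powr_ge_zero powr_add[symmetric])
  have B8: "8 \<le> B" using a_large constants by simp
  have AA: "(real a ^ j) powr \<theta> = A ^ j" for j
    using a by (simp add: A \<theta>_def powr_powr powr_realpow[symmetric] mult.commute)
  have BB: "(real a ^ j) powr (1 - \<theta>) = B ^ j" for j
    using a by (simp add: B \<theta>_def powr_powr powr_realpow[symmetric] mult.commute)
  have "0 \<le> 4 * M * c\<^sub>v * ((6 + 3 ^ Suc K) * a)"
    using constants a by (intro mult_nonneg_nonneg add_nonneg_nonneg) auto
  then have C3: "4 * M * c\<^sub>v * ((6 + 3 ^ Suc K) * a) \<le> C3" "14 * c\<^sub>e \<le> C3" "0 < C3"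
    using constants(3) unfolding C3 by linarith+
  define X where "X = (c\<^sub>P * D) powr d\<^sub>w"
  have X1: "1 \<le> X" using scale_ge_1 by (simp add: X_def)
  obtain I where I: "real a ^ I \<le> X" "X < real a ^ Suc I"
    using exists_power_bracket[OF X1 \<open>2 \<le> a\<close>] .
  define J where "J = Suc I"
  define \<rho> where "\<rho> j = (real a ^ j) powr (1 / d\<^sub>w)" for j
  have \<rho>_dw: "\<rho> j powr d\<^sub>w = real a ^ j" for j
    using a dw by (simp add: \<rho>_def powr_powr)
  have \<rho>_df: "\<rho> j powr d\<^sub>f = A ^ j" for j
    unfolding df powr_powr[symmetric] \<rho>_dw AA ..
  have \<rho>_ge_1: "1 \<le> \<rho> j" for j
    unfolding \<rho>_def using a dw by (intro ge_one_powr_ge_zero) auto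
  have \<rho>_le: "\<rho> j \<le> c\<^sub>P * D" if "j < J" for j
  proof -
    have "real a ^ j \<le> real a ^ I"
      using that a unfolding J_def by (intro power_increasing) auto
    also have "\<dots> \<le> X" by (rule I(1))
    finally have "\<rho> j \<le> X powr (1 / d\<^sub>w)"
      unfolding \<rho>_def using a dw by (intro powr_mono2) auto
    also have "\<dots> = c\<^sub>P * D"
      using large_diam dw by (simp add: X_def powr_powr)
    finally show ?thesis .
  qed
  have \<rho>_le_D: "\<rho> j \<le> D" if "j < J" for j
    using \<rho>_le[OF that] constants by (meson mult_left_le_one_le of_nat_0_le_iff order_trans less_imp_le)
  \<comment> \<open>Since \<open>c\<^sub>P * D\<close> lies between \<open>a ^ (I / d\<^sub>w)\<close> and \<open>a ^ (J / d\<^sub>w)\<close>, powers of the diameter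
    can be traded for powers of \<open>A\<close> (upper bounds) and of \<open>B\<close> (lower bounds).\<close>
  have X_eq: "X = c\<^sub>P powr d\<^sub>w * D powr d\<^sub>w"
    using constants by (simp add: X_def powr_mult)
  have "D powr d\<^sub>f = (c\<^sub>P powr d\<^sub>w * D powr d\<^sub>w) powr \<theta> * c\<^sub>P powr (- d\<^sub>f)"
    using constants D_ge_1 by (simp add: df powr_mult powr_powr powr_add[symmetric])
  also have "\<dots> \<le> (real a ^ J) powr \<theta> * c\<^sub>P powr (- d\<^sub>f)"
    using I X1 \<theta> unfolding X_eq[symmetric] J_def by (intro mult_right_mono powr_mono2) auto
  finally have D_df: "D powr d\<^sub>f \<le> A ^ J * c\<^sub>P powr (- d\<^sub>f)"
    unfolding AA .
  have "sum m V \<le> c\<^sub>v * (A ^ J * c\<^sub>P powr (- d\<^sub>f))"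
    using total_weight_le mult_left_mono[OF D_df, of c\<^sub>v] constants by linarith
  then have weight: "sum m V \<le> c\<^sub>v * c\<^sub>P powr (- d\<^sub>f) * A ^ J"
    by (simp add: mult_ac)
  have "B ^ I \<le> X powr (1 - \<theta>)"
    unfolding BB[symmetric] using I a \<theta> by (intro powr_mono2) auto
  also have "\<dots> \<le> (D powr d\<^sub>w) powr (1 - \<theta>)"
  proof (intro powr_mono2)
    show "X \<le> D powr d\<^sub>w"
      unfolding X_def using constants dw D_ge_1
      by (intro powr_mono2) (auto intro!: mult_left_le_one_le)
  qed (use \<theta> X1 in auto)
  also have "\<dots> = D powr d\<^sub>w / D powr d\<^sub>f"
    by (simp add: powr_powr df right_diff_distrib powr_diff)
  finally have D_diff: "B ^ I \<le> D powr d\<^sub>w / D powr d\<^sub>f" .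
  \<comment> \<open>\<open>\<beta>\<close> is the guaranteed value of the kernel at the top time, so \<open>t * \<beta>\<close> is the local time
    available at the start of the descent.\<close>
  define \<beta> where "\<beta> = 2 / (M ^ K * sum m V)"
  define b where "b j = t * \<beta> / (4 * M) ^ (J - j)" for j
  define \<tau> where "\<tau> j = (if j < J then 6 * a ^ j else top_time)" for j
  have "0 < \<beta>" using constants total_weight_pos by (simp add: \<beta>_def)
  have \<beta>_ge: "s * (2 / (M ^ K * c\<^sub>v)) * B ^ I \<le> t * \<beta>"
  proof -
    have "s * (2 / (M ^ K * c\<^sub>v)) * B ^ I \<le> s * (2 / (M ^ K * c\<^sub>v)) * (D powr d\<^sub>w / D powr d\<^sub>f)"
      using D_diff constants by (intro mult_left_mono) (auto simp: s_def)
    also have "\<dots> = t * (2 / (M ^ K * (c\<^sub>v * D powr d\<^sub>f)))"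
      using D_ge_1 by (simp add: s_def)
    also have "\<dots> \<le> t * \<beta>"
      unfolding \<beta>_def using total_weight_le total_weight_pos constants
      by (intro mult_left_mono divide_left_mono) auto
    finally show ?thesis .
  qed
  have ratio: "2 ^ i * (4 * M) ^ i \<le> B ^ i" for i
    unfolding power_mult_distrib[symmetric] using a_large constants by (intro power_mono) auto
  have b_ge: "\<kappa> * s * 2 ^ (J - j) \<le> b (Suc j) / (8 * (C3 * B ^ j))" if j: "j < J" for j
  proof -
    define i where "i = I - j"
    have i: "J - j = Suc i" "J - Suc j = i" "I = i + j"
      using j by (auto simp: i_def J_def)
    have "\<kappa> * s * 2 ^ (J - j) = (s * (2 / (M ^ K * c\<^sub>v)) * 2 ^ i / (8 * C3)) / B"
      unfolding \<kappa> i by (simp add: field_simps)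
    also have "\<dots> \<le> s * (2 / (M ^ K * c\<^sub>v)) * 2 ^ i / (8 * C3) / 1"
      using B8 C3 constants by (intro divide_left_mono) (auto simp: s_def)
    also have "\<dots> \<le> s * (2 / (M ^ K * c\<^sub>v)) * (B ^ i / (4 * M) ^ i) / (8 * C3) / 1"
      using ratio[of i] C3 constants
      by (intro divide_right_mono mult_left_mono) (auto simp: s_def pos_le_divide_eq)
    also have "\<dots> = s * (2 / (M ^ K * c\<^sub>v)) * B ^ I / (4 * M) ^ i / (8 * (C3 * B ^ j))"
      using B8 by (simp add: i power_add field_simps)
    also have "\<dots> \<le> t * \<beta> / (4 * M) ^ i / (8 * (C3 * B ^ j))"
      using \<beta>_ge C3 B8 constants by (intro divide_right_mono) auto
    finally show ?thesis by (simp add: b_def i)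
  qed
  \<comment> \<open>The bottom step starts from \<open>b 0\<close> with a bounded potential; it lacks one factor \<open>B\<close>, which is
    why \<open>\<kappa>\<close> carries \<open>1 / B\<close>.\<close>
  have b0_ge: "\<kappa> * s * 2 ^ J \<le> b 0 / (8 * C3)"
  proof -
    have "\<kappa> * s * 2 ^ J = s * (1 / (M ^ K * c\<^sub>v)) * 2 ^ J / B / (8 * C3)"
      unfolding \<kappa> by (simp add: field_simps)
    also have "\<dots> \<le> s * (2 / (M ^ K * c\<^sub>v)) * (B ^ J / (4 * M) ^ J) / B / (8 * C3)"
      using ratio[of J] C3 constants B8
      by (intro divide_right_mono mult_mono) (auto simp: s_def pos_le_divide_eq divide_right_mono)
    also have "\<dots> = s * (2 / (M ^ K * c\<^sub>v)) * B ^ I / (4 * M) ^ J / (8 * C3)"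
      using B8 by (simp add: J_def)
    also have "\<dots> \<le> t * \<beta> / (4 * M) ^ J / (8 * C3)"
      using \<beta>_ge C3 constants by (intro divide_right_mono) auto
    finally show ?thesis by (simp add: b_def)
  qed
  have \<tau>_le: "\<tau> (Suc j) \<le> (6 + 3 ^ Suc K) * a * a ^ j" and \<tau>_ge: "2 * a ^ j \<le> \<tau> (Suc j)" if j: "j < J" for j
  proof -
    have "real (\<tau> (Suc j)) \<le> (6 + 3 ^ Suc K) * real a * real a ^ j \<and> 2 * real a ^ j \<le> \<tau> (Suc j)"
    proof (cases "Suc j < J")
      case True
      have "1 * real a ^ j \<le> a * real a ^ j"
        using a by (intro mult_right_mono) auto
      moreover have "0 \<le> real a * real a ^ j"
        by simp
      moreover have "0 \<le> 3 ^ Suc K * (real a * real a ^ j)"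
        by simp
      ultimately show ?thesis
        using True by (simp add: \<tau>_def distrib_right mult.assoc; linarith)
    next
      case False
      then have "j = I" using j by (simp add: J_def)
      have "real top_time \<le> 3 ^ Suc K * X"
        using top_time_bounds(2) by (simp add: X_def)
      also have "\<dots> \<le> 3 ^ Suc K * (real a * real a ^ I)"
        using I(2) by (intro mult_left_mono) auto
      finally have "real top_time \<le> 3 ^ Suc K * (real a * real a ^ I)" .
      moreover have "0 \<le> 6 * (real a * real a ^ I)" by simp
      moreover have "2 * real a ^ I \<le> top_time"
        using top_time_bounds(1) I(1) unfolding X_def[symmetric] by linarith
      ultimately show ?thesis
        using False \<open>j = I\<close> by (simp only: \<tau>_def if_False distrib_right mult.assoc simp_thms)
    qed
    then show "\<tau> (Suc j) \<le> (6 + 3 ^ Suc K) * a * a ^ j" "2 * a ^ j \<le> \<tau> (Suc j)"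
      by (auto simp: of_nat_le_iff[where 'a = real, symmetric] simp del: of_nat_le_iff)
  qed
  define \<epsilon> where "\<epsilon> j = sum m V * (2 * exp (- b (Suc j) / (8 * (C3 * B ^ j)))) / (inverse c\<^sub>v * A ^ j)" for j
  have "measure (walk z) (uncovered t) \<le> card V * (2 * exp (- b 0 / (8 * C3))) + sum \<epsilon> {..<J}"
  proof (rule prob_uncovered_le_cascade[OF z, where k = \<tau> and J = J])
    show "0 < C3" by fact
    show "0 \<le> b 0" using \<open>0 < \<beta>\<close> constants by (simp add: b_def)
    show "2 * (\<Sum>i\<le>\<tau> 0. heat i x w) \<le> C3" if "x \<in> V" "w \<in> V" for x w
      using sum_bounded_above[of "{..6}" "\<lambda>i. heat i x w" c\<^sub>e] heat_le[OF that] C3(2)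
      by (simp add: \<tau>_def J_def)
    show "b J \<le> local_time (\<tau> J) t x \<omega>" if "x \<in> V" "\<And>s. s \<le> t \<Longrightarrow> \<omega> s \<in> V" for x \<omega>
      using sum_bounded_below[of "{..<t}" \<beta> "\<lambda>s. heat2 top_time x (\<omega> s)"] heat2_top_time_ge that
      by (simp add: b_def \<tau>_def \<beta>_def)
    show "measure (walk z) {\<omega>. (\<forall>s\<le>t. \<omega> s \<in> V) \<and>
        (\<forall>x\<in>V. b (Suc j) \<le> local_time (\<tau> (Suc j)) t x \<omega>) \<and> (\<exists>x\<in>V. local_time (\<tau> j) t x \<omega> < b j)} \<le> \<epsilon> j"
      if j: "j < J" for j
    proof -
      have bj: "b j = b (Suc j) / (4 * M)"
        using j Suc_diff_Suc[OF j] unfolding b_def by (metis divide_divide_eq_left' power_Suc)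
      have n: "2 * \<rho> j powr d\<^sub>w \<le> real (2 * a ^ j)" "real (2 * a ^ j) \<le> 3 ^ Suc K * \<rho> j powr d\<^sub>w"
      proof -
        have "(1 :: real) \<le> 3 ^ K"
          by simp
        then have "2 \<le> (3 :: real) ^ Suc K"
          unfolding power_Suc by linarith
        then show "real (2 * a ^ j) \<le> 3 ^ Suc K * \<rho> j powr d\<^sub>w"
          unfolding \<rho>_dw using mult_right_mono[of 2 "3 ^ Suc K" "real a ^ j"]
          by (simp only: of_nat_mult of_nat_power of_nat_numeral of_nat_0_le_iff zero_le_power simp_thms)
      qed (simp add: \<rho>_dw)
      show ?thesis
        unfolding bj \<epsilon>_def
      proof (rule prob_local_time_drop_le[OF z, where W = "\<lambda>x. gball V E x (\<rho> j)" and n = "2 * a ^ j"])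
        show "0 < C3 * B ^ j" "0 < inverse c\<^sub>v * A ^ j"
          using C3 B8 A1 constants by auto
        show "0 < M" using constants by simp
        show "2 * a ^ j \<le> \<tau> (Suc j)" by (rule \<tau>_ge[OF j])
        show "gball V E x (\<rho> j) \<subseteq> V \<and> inverse c\<^sub>v * A ^ j \<le> sum m (gball V E x (\<rho> j))" if "x \<in> V" for x
          using volume[OF that \<rho>_ge_1 \<rho>_le_D[OF j]] gball_subset unfolding \<rho>_df by simp
        show "heat2 (2 * a ^ j) y w \<le> M * heat2 (\<tau> j) x w"
          if x: "x \<in> V" and y: "y \<in> gball V E x (\<rho> j)" and w: "w \<in> V" for x y w
        proof -
          have yV: "y \<in> V" using y gball_subset by blast
          have "heat2 (2 * a ^ j) w y \<le> M * heat2 (3 * (2 * a ^ j)) w x"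
            using x \<rho>_ge_1[of j]
            by (intro harnack[OF w x y _ \<rho>_ge_1 \<rho>_le[OF j] n]) (simp add: gball_def)
          then show ?thesis
            using heat2_sym[OF w yV] heat2_sym[OF w x] j by (simp add: \<tau>_def)
        qed
        show "(\<Sum>i\<in>{2 * a ^ j..<\<tau> (Suc j)}. heat2 i x w) \<le> C3 * B ^ j" if x: "x \<in> V" and w: "w \<in> V" for x w
        proof -
          let ?H = "4 * M * c\<^sub>v * \<rho> j powr (- d\<^sub>f)"
          have "(\<Sum>i\<in>{2 * a ^ j..<\<tau> (Suc j)}. heat2 i x w) \<le> real (card {2 * a ^ j..<\<tau> (Suc j)}) * ?H"
            by (intro sum_bounded_above heat2_le[OF x w \<rho>_ge_1 \<rho>_le[OF j] n]) simp
          also have "\<dots> \<le> ((6 + 3 ^ Suc K) * a * a ^ j) * ?H"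
            using \<tau>_le[OF j] constants by (intro mult_right_mono) (auto simp: of_nat_le_iff[where 'a = real, symmetric] simp del: of_nat_le_iff)
          also have "\<dots> = 4 * M * c\<^sub>v * ((6 + 3 ^ Suc K) * a) * B ^ j"
            using A1 by (simp add: powr_minus \<rho>_df AB[symmetric] power_mult_distrib field_simps)
          also have "\<dots> \<le> C3 * B ^ j"
            using C3(1) B8 by (intro mult_right_mono) auto
          finally show ?thesis .
        qed
      qed
    qed
  qed
  also have "\<dots> \<le> C * (A ^ J * exp (- (\<kappa> * s * 2 ^ J))) + (\<Sum>j<J. C * (A ^ (J - j) * exp (- (\<kappa> * s * 2 ^ (J - j)))))"
  proof (intro add_mono sum_mono)
    define W where "W = c\<^sub>v * c\<^sub>P powr (- d\<^sub>f)"
    have W: "0 \<le> W" "C = 2 * (c\<^sub>v + c\<^sub>e) * W" "sum m V \<le> W * A ^ J"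
      using constants weight by (auto simp: W_def C)
    have "real (card V) \<le> c\<^sub>e * (W * A ^ J)"
      using card_le mult_left_mono[OF W(3), of c\<^sub>e] constants by linarith
    also have "\<dots> \<le> (c\<^sub>v + c\<^sub>e) * (W * A ^ J)"
      using W A1 constants by (intro mult_right_mono) auto
    finally have card: "card V \<le> (c\<^sub>v + c\<^sub>e) * (W * A ^ J)" .
    have "card V * (2 * exp (- b 0 / (8 * C3))) \<le> (c\<^sub>v + c\<^sub>e) * (W * A ^ J) * (2 * exp (- (\<kappa> * s * 2 ^ J)))"
      using b0_ge card W A1 constants by (intro mult_mono) auto
    also have "\<dots> = C * (A ^ J * exp (- (\<kappa> * s * 2 ^ J)))"
      unfolding W(2) by (simp only: mult_ac)
    finally show "card V * (2 * exp (- b 0 / (8 * C3))) \<le> C * (A ^ J * exp (- (\<kappa> * s * 2 ^ J)))" .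
    fix j assume "j \<in> {..<J}"
    then have j: "j < J" by simp
    have "\<epsilon> j \<le> (W * A ^ J) * (2 * exp (- (\<kappa> * s * 2 ^ (J - j)))) / (inverse c\<^sub>v * A ^ j)"
      unfolding \<epsilon>_def using b_ge[OF j] W A1 constants
      by (intro divide_right_mono mult_mono) auto
    also have "\<dots> = 2 * c\<^sub>v * W * (A ^ (J - j) * exp (- (\<kappa> * s * 2 ^ (J - j))))"
      using A1 j constants by (simp add: power_diff field_simps)
    also have "\<dots> \<le> C * (A ^ (J - j) * exp (- (\<kappa> * s * 2 ^ (J - j))))"
      unfolding W(2) using W(1) A1 constants by (intro mult_right_mono) auto
    finally show "\<epsilon> j \<le> C * (A ^ (J - j) * exp (- (\<kappa> * s * 2 ^ (J - j))))" .
  qed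
  also have "\<dots> \<le> 2 * C * (\<Sum>i\<le>J. A ^ i * exp (- (\<kappa> * s * 2 ^ i)))"
  proof -
    let ?e = "\<lambda>i. A ^ i * exp (- (\<kappa> * s * 2 ^ i))"
    have nn: "0 \<le> ?e i" for i using A1 by simp
    have "(\<Sum>j<J. ?e (J - j)) = sum ?e {1..J}"
      by (rule sum.reindex_bij_witness[of _ "\<lambda>i. J - i" "\<lambda>j. J - j"]) auto
    also have "\<dots> \<le> sum ?e {..J}"
      using nn by (intro sum_mono2) auto
    finally have "(\<Sum>j<J. ?e (J - j)) \<le> sum ?e {..J}" .
    moreover have "?e J \<le> sum ?e {..J}"
      using nn by (intro member_le_sum) auto
    ultimately have "?e J + (\<Sum>j<J. ?e (J - j)) \<le> 2 * sum ?e {..J}"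
      by simp
    moreover have "0 \<le> C" using constants by (simp add: C)
    ultimately have "C * (?e J + (\<Sum>j<J. ?e (J - j))) \<le> C * (2 * sum ?e {..J})"
      by (rule mult_left_mono)
    then show ?thesis
      by (simp add: sum_distrib_left[symmetric] distrib_left mult_ac)
  qed
  finally show ?thesis
    unfolding s_def by blast
qed

end

text \<open>
  For $s \ge 1$ one has $s\,2^i \ge (s + 2^i)/2$, which separates the decay in $s$ from the convergence of the
  series.
\<close>

lemma doubling_exponential_sum_bound:
  fixes A \<kappa> :: real
  assumes "0 \<le> A" "0 < \<kappa>"
  obtains S where "0 < S"
    and "\<And>J s. 1 \<le> s \<Longrightarrow> (\<Sum>i\<le>J. A ^ i * exp (- (\<kappa> * s * 2 ^ i))) \<le> S * exp (- (\<kappa> / 2 * s))"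
proof -
  let ?f = "\<lambda>i. A ^ i * exp (- (\<kappa> / 2 * 2 ^ i))"
  have "summable ?f"
  proof -
    have "(\<lambda>i. A * exp (- (\<kappa> / 2 * 2 ^ i))) \<longlonglongrightarrow> 0"
      using assms by real_asymp
    then have "eventually (\<lambda>i. A * exp (- (\<kappa> / 2 * 2 ^ i)) < 1 / 2) sequentially"
      by (rule order_tendstoD) simp
    then obtain N where N: "\<And>i. N \<le> i \<Longrightarrow> A * exp (- (\<kappa> / 2 * 2 ^ i)) < 1 / 2"
      by (auto simp: eventually_sequentially)
    show ?thesis
    proof (rule summable_ratio_test[where c = "1 / 2" and N = N])
      fix i assume "N \<le> i"
      have "?f (Suc i) = (A * exp (- (\<kappa> / 2 * 2 ^ i))) * ?f i"
        by (simp add: exp_add[symmetric] mult_ac)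
      also have "\<dots> \<le> 1 / 2 * ?f i"
        using N[OF \<open>N \<le> i\<close>] assms by (intro mult_right_mono) auto
      finally show "norm (?f (Suc i)) \<le> 1 / 2 * norm (?f i)"
        using assms by simp
    qed simp
  qed
  have nn: "0 \<le> ?f i" for i using assms by simp
  show ?thesis
  proof (rule that[of "suminf ?f + 1"])
    show "0 < suminf ?f + 1"
      using suminf_nonneg[OF \<open>summable ?f\<close>] nn by (simp add: add_nonneg_pos)
    fix J and s :: real assume s: "1 \<le> s"
    have "(\<Sum>i\<le>J. A ^ i * exp (- (\<kappa> * s * 2 ^ i))) \<le> (\<Sum>i\<le>J. ?f i * exp (- (\<kappa> / 2 * s)))"
    proof (rule sum_mono)
      fix i
      have "0 \<le> (s - 1) * (2 ^ i - 1) + (s * 2 ^ i - 1)"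
        using s mult_mono[of 1 s 1 "2 ^ i"] by (intro add_nonneg_nonneg mult_nonneg_nonneg) auto
      then have "s + 2 ^ i \<le> 2 * (s * 2 ^ i)"
        by (simp add: algebra_simps)
      then have "\<kappa> / 2 * (s + 2 ^ i) \<le> \<kappa> / 2 * (2 * (s * 2 ^ i))"
        using assms by (intro mult_left_mono) auto
      then have "\<kappa> / 2 * 2 ^ i + \<kappa> / 2 * s \<le> \<kappa> * s * 2 ^ i"
        by (simp add: distrib_left mult_ac)
      then have "exp (- (\<kappa> * s * 2 ^ i)) \<le> exp (- (\<kappa> / 2 * 2 ^ i)) * exp (- (\<kappa> / 2 * s))"
        unfolding exp_add[symmetric] by simp
      then have "A ^ i * exp (- (\<kappa> * s * 2 ^ i)) \<le> A ^ i * (exp (- (\<kappa> / 2 * 2 ^ i)) * exp (- (\<kappa> / 2 * s)))"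
        using assms by (intro mult_left_mono) auto
      then show "A ^ i * exp (- (\<kappa> * s * 2 ^ i)) \<le> ?f i * exp (- (\<kappa> / 2 * s))"
        by (simp only: mult.assoc)
    qed
    also have "\<dots> = (\<Sum>i\<le>J. ?f i) * exp (- (\<kappa> / 2 * s))"
      by (simp add: sum_distrib_right)
    also have "\<dots> \<le> (suminf ?f + 1) * exp (- (\<kappa> / 2 * s))"
    proof (intro mult_right_mono)
      have "(\<Sum>i\<le>J. ?f i) \<le> suminf ?f"
        using nn \<open>summable ?f\<close> by (intro sum_le_suminf) auto
      then show "(\<Sum>i\<le>J. ?f i) \<le> suminf ?f + 1" by simp
    qed simp
    finally show "(\<Sum>i\<le>J. A ^ i * exp (- (\<kappa> * s * 2 ^ i))) \<le> (suminf ?f + 1) * exp (- (\<kappa> / 2 * s))" .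
  qed
qed

lemma exponential_tail_mono:
  fixes c c' t T :: real
  assumes "0 < c" "c \<le> c'" "0 \<le> t" "0 < T" "T \<le> T'"
  shows "c * exp (- t / (c * T)) \<le> c' * exp (- t / (c' * T'))"
proof (intro mult_mono)
  have "t / (c' * T') \<le> t / (c * T)"
    using assms by (intro divide_left_mono mult_mono mult_pos_pos) auto
  then show "exp (- t / (c * T)) \<le> exp (- t / (c' * T'))"
    by simp
qed (use assms in auto)

section \<open>Uniform tails of the cover time\<close>

text \<open>
  For $t \ge D^{d_w}$ this is the sum over the scales; for smaller $t$ the bound exceeds $1$ as soon as
  $c \ge 2$, because $2 e^{-1/2} > 1$.
\<close>

lemma uniform_cover_time_tail:
  fixes d\<^sub>f d\<^sub>w c\<^sub>P c\<^sub>e c\<^sub>v M :: real and K :: nat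
  assumes exponents: "0 < d\<^sub>f" "1 \<le> d\<^sub>w" "d\<^sub>f < d\<^sub>w"
    and constants: "0 < c\<^sub>P" "0 < c\<^sub>e" "0 < c\<^sub>v" "1 \<le> M"
  obtains c where "0 < c"
    and "\<And>(V :: 'a set) E \<mu> z t. harnack_graph V E \<mu> d\<^sub>f d\<^sub>w c\<^sub>P c\<^sub>e c\<^sub>v M K \<Longrightarrow> z \<in> V \<Longrightarrow>
      measure (lazy_walk_law E \<mu> z) {\<omega> \<in> space (lazy_walk_law E \<mu> z). enat t < cover_time V \<omega>}
      \<le> c * exp (- real t / (c * real (gdiam V E) powr d\<^sub>w))"
proof -
  define \<theta> where "\<theta> = d\<^sub>f / d\<^sub>w"
  have \<theta>: "0 < \<theta>" "\<theta> < 1" using exponents by (auto simp: \<theta>_def)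
  have "filterlim (\<lambda>n. real n powr (1 - \<theta>)) at_top sequentially"
    using \<theta> by real_asymp
  then have "eventually (\<lambda>n. 8 * M \<le> real n powr (1 - \<theta>) \<and> 2 \<le> n) sequentially"
    using eventually_ge_at_top[of "2::nat"] by (auto simp: filterlim_at_top intro: eventually_conj)
  then obtain a :: nat where a: "8 * M \<le> real a powr (1 - \<theta>)" "2 \<le> a"
    by (auto simp: eventually_sequentially)
  define A where "A = real a powr \<theta>"
  define B where "B = real a powr (1 - \<theta>)"
  define C where "C = 2 * (c\<^sub>v + c\<^sub>e) * (c\<^sub>v * c\<^sub>P powr (- d\<^sub>f))"
  define C3 where "C3 = 4 * M * c\<^sub>v * ((6 + 3 ^ Suc K) * a) + 14 * c\<^sub>e"
  define \<kappa> where "\<kappa> = 1 / (8 * C3 * (M ^ K * c\<^sub>v) * B)"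
  have pos: "0 \<le> A" "0 < B" "0 < C" "0 < C3"
    using constants a(2) by (auto simp: A_def B_def C_def C3_def intro!: add_pos_pos mult_pos_pos)
  then have \<kappa>: "0 < \<kappa>"
    using constants by (auto simp: \<kappa>_def)
  obtain S where S: "0 < S" "\<And>J s. 1 \<le> s \<Longrightarrow>
      (\<Sum>i\<le>J. A ^ i * exp (- (\<kappa> * s * 2 ^ i))) \<le> S * exp (- (\<kappa> / 2 * s))"
    using doubling_exponential_sum_bound[OF pos(1) \<kappa>] by blast
  define c where "c = 2 * C * S + 2 / \<kappa> + 2"
  have c: "2 * C * S \<le> c" "2 / \<kappa> \<le> c" "2 \<le> c" "0 < 2 / \<kappa>"
    using pos S(1) \<kappa> by (auto simp: c_def add_increasing add_increasing2)
  show ?thesis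
  proof (rule that[of c])
    show "0 < c" using c by simp
    fix V :: "'a set" and E \<mu> z and t :: nat
    assume "harnack_graph V E \<mu> d\<^sub>f d\<^sub>w c\<^sub>P c\<^sub>e c\<^sub>v M K" and z: "z \<in> V"
    then interpret harnack_graph V E \<mu> d\<^sub>f d\<^sub>w c\<^sub>P c\<^sub>e c\<^sub>v M K by simp
    interpret W: prob_space "walk z" by (rule prob_space_walk)
    define s where "s = t / D powr d\<^sub>w"
    have "measure (walk z) {\<omega> \<in> space (walk z). enat t < cover_time V \<omega>} \<le> c * exp (- (s / c))"
    proof (cases "1 \<le> s")
      case True
      obtain J where J: "measure (walk z) (uncovered t)
          \<le> 2 * C * (\<Sum>i\<le>J. A ^ i * exp (- (\<kappa> * (t / D powr d\<^sub>w) * 2 ^ i)))"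
        using prob_uncovered_le_sum[OF z a(2) A_def[unfolded \<theta>_def] B_def[unfolded \<theta>_def] _ C_def C3_def \<kappa>_def]
          a(1) unfolding B_def by blast
      have "measure (walk z) {\<omega> \<in> space (walk z). enat t < cover_time V \<omega>} \<le> measure (walk z) (uncovered t)"
        by (rule cover_time_tail_le_uncovered[OF z])
      also have "\<dots> \<le> 2 * C * (\<Sum>i\<le>J. A ^ i * exp (- (\<kappa> * s * 2 ^ i)))"
        using J by (simp add: s_def)
      also have "\<dots> \<le> 2 * C * (S * exp (- (\<kappa> / 2 * s)))"
        using pos True by (intro mult_left_mono S) auto
      also have "\<dots> = (2 * C * S) * exp (- (s / (2 / \<kappa>)))"
        by simp
      also have "\<dots> \<le> c * exp (- (s / c))"
      proof (intro mult_mono)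
        show "exp (- (s / (2 / \<kappa>))) \<le> exp (- (s / c))"
          using c True by (intro exp_mono le_imp_neg_le divide_left_mono mult_pos_pos) auto
      qed (use c in auto)
      finally show ?thesis .
    next
      case False
      then have "s / c \<le> 1 / 2"
        using c by (simp add: field_simps)
      then have "1 - 1 / 2 \<le> exp (- (s / c))"
        using exp_ge_add_one_self[of "- (s / c)"] by linarith
      then have "2 * (1 / 2) \<le> c * exp (- (s / c))"
        using c by (intro mult_mono) auto
      then show ?thesis
        using W.prob_le_1[of "{\<omega> \<in> space (walk z). enat t < cover_time V \<omega>}"] by linarith
    qed
    then show "measure (walk z) {\<omega> \<in> space (walk z). enat t < cover_time V \<omega>}
        \<le> c * exp (- real t / (c * D powr d\<^sub>w))"
      by (simp add: s_def mult.commute)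
  qed
qed

lemma gdiam_singleton:
  assumes "card V = 1"
  shows "gdiam V E = 0"
proof -
  obtain x where x: "V = {x}"
    using assms by (auto simp: card_1_singleton_iff)
  have "gdist E x x = 0"
    unfolding gdist_def by (rule Least_eq_0) simp
  then have "{gdist E y z | y z. y \<in> V \<and> z \<in> V} = {0}"
    by (auto simp: x)
  then show ?thesis
    by (simp add: gdiam_def)
qed

theorem proposition1p5:
  fixes d\<^sub>f d\<^sub>w :: real
    and V :: "nat \<Rightarrow> 'a set"
    and E :: "nat \<Rightarrow> 'a set set"
    and \<mu> :: "nat \<Rightarrow> 'a \<Rightarrow> 'a \<Rightarrow> real"
  assumes "1 \<le> d\<^sub>f" and "2 \<le> d\<^sub>w" and "d\<^sub>f < d\<^sub>w"
    and "\<And>N. 1 \<le> N \<Longrightarrow> finite_weighted_graph (V N) (E N) (\<mu> N)"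
    and "filterlim (\<lambda>N. card (V N)) at_top sequentially"
    and "uniform_weight_conditions d\<^sub>f V E \<mu>"
    and "UPHI d\<^sub>w V E \<mu>"
  shows "\<exists>c\<^sub>0>0. \<forall>t::nat. \<forall>N\<ge>1.
    (SUP z\<in>V N. measure (lazy_walk_law (E N) (\<mu> N) z)
        {\<omega> \<in> space (lazy_walk_law (E N) (\<mu> N) z). enat t < cover_time (V N) \<omega>})
    \<le> c\<^sub>0 * exp (- real t / (c\<^sub>0 * real (gdiam (V N) (E N)) powr d\<^sub>w))"
proof -
  note graphs = assms(4)
  let ?D = "\<lambda>N. real (gdiam (V N) (E N))"
  let ?tail = "\<lambda>N z t. measure (lazy_walk_law (E N) (\<mu> N) z)
        {\<omega> \<in> space (lazy_walk_law (E N) (\<mu> N) z). enat t < cover_time (V N) \<omega>}"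
  obtain c\<^sub>e c\<^sub>v p\<^sub>0 where ce: "0 < c\<^sub>e" and cv: "0 < c\<^sub>v" and "0 < p\<^sub>0"
    and weights: "\<forall>N\<ge>1.
         (\<forall>x y. {x, y} \<in> E N \<longrightarrow>
            inverse c\<^sub>e \<le> \<mu> N x y \<and> \<mu> N x y \<le> c\<^sub>e \<and>
            p\<^sub>0 \<le> \<mu> N x y / vertex_weight (E N) (\<mu> N) x) \<and>
         (\<forall>x\<in>V N. \<forall>r::real. 1 \<le> r \<and> r \<le> ?D N \<longrightarrow>
            inverse c\<^sub>v * r powr d\<^sub>f \<le> ball_volume (V N) (E N) (\<mu> N) x r \<and>
            ball_volume (V N) (E N) (\<mu> N) x r \<le> c\<^sub>v * r powr d\<^sub>f)"
    and diam: "filterlim (\<lambda>N. gdiam (V N) (E N)) at_top sequentially"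
    using assms(6) unfolding uniform_weight_conditions_def by (elim exE conjE)
  have edge: "inverse c\<^sub>e \<le> \<mu> N x y" if "1 \<le> N" "{x, y} \<in> E N" for N x y
    using weights that by blast
  have vol: "inverse c\<^sub>v * r powr d\<^sub>f \<le> ball_volume (V N) (E N) (\<mu> N) x r \<and>
      ball_volume (V N) (E N) (\<mu> N) x r \<le> c\<^sub>v * r powr d\<^sub>f"
    if "1 \<le> N" "x \<in> V N" "1 \<le> r" "r \<le> ?D N" for N x r
    using weights that by blast
  \<comment> \<open>The chaining number \<open>K\<close> depends on \<open>c\<^sub>P\<close> only, so it may enter the comparison constant for
    which \<open>C\<^sub>P\<close> is obtained.\<close>
  let ?PHI = "\<lambda>c\<^sub>P c C\<^sub>P. \<forall>N\<ge>1. \<forall>x\<^sub>0\<in>V N. \<forall>R T::real.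
          1 \<le> R \<and> R \<le> c\<^sub>P * ?D N \<and> 2 * R \<le> T \<and>
          inverse c * R powr d\<^sub>w \<le> T \<and> T \<le> c * R powr d\<^sub>w \<longrightarrow>
          (\<forall>u. (\<forall>t. \<forall>x\<in>V N. 0 \<le> u t x) \<and>
               caloric_on (V N) (E N) (\<mu> N) (4 * T) (gball (V N) (E N) x\<^sub>0 (2 * R)) u \<longrightarrow>
             Max {u s z | s z. z \<in> gball (V N) (E N) x\<^sub>0 R \<and> T \<le> real s \<and> real s \<le> 2 * T}
             \<le> C\<^sub>P * Min {u s z + u (Suc s) z | s z.
                     z \<in> gball (V N) (E N) x\<^sub>0 R \<and> 3 * T \<le> real s \<and> real s \<le> 4 * T})"
  obtain c\<^sub>P where cP: "0 < c\<^sub>P" "c\<^sub>P \<le> 1" and PHI: "\<forall>c>0. \<exists>C\<^sub>P::real. ?PHI c\<^sub>P c C\<^sub>P"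
    using assms(7) unfolding UPHI_def by (elim exE conjE)
  define K where "K = nat \<lceil>2 / c\<^sub>P\<rceil>"
  have "2 / c\<^sub>P \<le> K"
    unfolding K_def by (rule real_nat_ceiling_ge)
  then have K: "2 \<le> c\<^sub>P * K"
    using cP by (simp add: field_simps)
  have "(0::real) < 3 ^ Suc K" by simp
  with PHI have "\<exists>C\<^sub>P::real. ?PHI c\<^sub>P (3 ^ Suc K) C\<^sub>P"
    by (elim allE impE)
  then obtain C\<^sub>P :: real where CP: "?PHI c\<^sub>P (3 ^ Suc K) C\<^sub>P"
    by (elim exE)
  define M where "M = 2 * max C\<^sub>P 1"
  have M: "1 \<le> M" by (simp add: M_def)
  have harnack: "harnack_graph (V N) (E N) (\<mu> N) d\<^sub>f d\<^sub>w c\<^sub>P c\<^sub>e c\<^sub>v M K"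
    if N: "1 \<le> N" and card: "1 < card (V N)" and large: "1 \<le> c\<^sub>P * ?D N" for N
  proof -
    interpret weighted_graph "V N" "E N" "\<mu> N"
      using graphs[OF N] card by (rule weighted_graph.intro)
    show ?thesis
    proof
      show "inverse c\<^sub>e \<le> m x" if x: "x \<in> V N" for x
      proof -
        obtain y where y: "{x, y} \<in> E N" using exists_neighbour[OF x] by blast
        show ?thesis using edge[OF N y] m_ge_mu[OF x y] by simp
      qed
      show "inverse c\<^sub>v * r powr d\<^sub>f \<le> sum m (gball (V N) (E N) x r) \<and>
          sum m (gball (V N) (E N) x r) \<le> c\<^sub>v * r powr d\<^sub>f"
        if "x \<in> V N" "1 \<le> r" "r \<le> ?D N" for x r
        using vol[OF N that] by (simp add: ball_volume_def)
      show "heat2 n x z \<le> M * heat2 (3 * n) x z'"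
        if x: "x \<in> V N" and x0: "x0 \<in> V N" and z: "z \<in> gball (V N) (E N) x0 R" "z' \<in> gball (V N) (E N) x0 R"
          and R: "1 \<le> R" "R \<le> c\<^sub>P * ?D N" and n: "2 * R powr d\<^sub>w \<le> real n" "real n \<le> 3 ^ Suc K * R powr d\<^sub>w"
        for x x0 z z' n R
        unfolding M_def
      proof (rule heat2_harnack[OF x _ z])
        have "R powr 1 \<le> R powr d\<^sub>w"
          using R assms(2) by (intro powr_mono) auto
        then have RR: "R \<le> R powr d\<^sub>w" using R by simp
        then show "0 < n" using n R by (cases n) auto
        have "inverse (3 ^ Suc K :: real) \<le> 1"
          by (intro inverse_le_1_iff[THEN iffD2] disjI2 one_le_power) simp
        then have "inverse (3 ^ Suc K) * R powr d\<^sub>w \<le> 1 * R powr d\<^sub>w"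
          by (intro mult_right_mono) auto
        then have "1 \<le> R \<and> R \<le> c\<^sub>P * ?D N \<and> 2 * R \<le> real n \<and>
          inverse (3 ^ Suc K) * R powr d\<^sub>w \<le> real n \<and> real n \<le> 3 ^ Suc K * R powr d\<^sub>w"
          using R RR n by linarith
        from CP[THEN spec, THEN mp, OF N, THEN bspec, OF x0, THEN spec, THEN spec, THEN mp, OF this]
        show "Max {u s z | s z. z \<in> gball (V N) (E N) x0 R \<and> real n \<le> real s \<and> real s \<le> 2 * real n}
          \<le> C\<^sub>P * Min {u s z + u (Suc s) z | s z. z \<in> gball (V N) (E N) x0 R \<and> 3 * real n \<le> real s \<and> real s \<le> 4 * real n}"
          if "(\<forall>t. \<forall>x\<in>V N. 0 \<le> u t x) \<and> caloric_on (V N) (E N) (\<mu> N) (4 * real n) (gball (V N) (E N) x0 (2 * R)) u" for u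
          using that by blast
      qed auto
    qed (use assms(1-3) cP ce cv M K large in auto)
  qed
  obtain c\<^sub>1 where c1: "0 < c\<^sub>1" "\<And>(V :: 'a set) E \<mu> z t. harnack_graph V E \<mu> d\<^sub>f d\<^sub>w c\<^sub>P c\<^sub>e c\<^sub>v M K \<Longrightarrow> z \<in> V \<Longrightarrow>
      measure (lazy_walk_law E \<mu> z) {\<omega> \<in> space (lazy_walk_law E \<mu> z). enat t < cover_time V \<omega>}
      \<le> c\<^sub>1 * exp (- real t / (c\<^sub>1 * real (gdiam V E) powr d\<^sub>w))"
    using uniform_cover_time_tail[of d\<^sub>f d\<^sub>w c\<^sub>P c\<^sub>e c\<^sub>v M K thesis] assms(1-3) cP ce cv M by auto
  have "eventually (\<lambda>N. nat \<lceil>1 / c\<^sub>P\<rceil> \<le> gdiam (V N) (E N)) sequentially"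
    using diam unfolding filterlim_at_top by (rule spec)
  then obtain N\<^sub>0 where N0: "\<And>N. N\<^sub>0 \<le> N \<Longrightarrow> nat \<lceil>1 / c\<^sub>P\<rceil> \<le> gdiam (V N) (E N)"
    by (auto simp: eventually_sequentially)
  have large: "1 \<le> c\<^sub>P * ?D N" if "N\<^sub>0 \<le> N" for N
  proof -
    have "1 / c\<^sub>P \<le> ?D N"
      using N0[OF that] real_nat_ceiling_ge[of "1 / c\<^sub>P"] by linarith
    then show ?thesis using cP by (simp add: field_simps)
  qed
  \<comment> \<open>Finitely many graphs have too small a diameter; each contributes its own constant.\<close>
  have "\<forall>N. \<exists>c>0. 1 \<le> N \<and> 1 < card (V N) \<longrightarrow> (\<forall>z\<in>V N. \<forall>t. ?tail N z t \<le> c * exp (- real t / c))"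
  proof
    fix N
    show "\<exists>c>0. 1 \<le> N \<and> 1 < card (V N) \<longrightarrow> (\<forall>z\<in>V N. \<forall>t. ?tail N z t \<le> c * exp (- real t / c))"
    proof (cases "1 \<le> N \<and> 1 < card (V N)")
      case True
      then interpret weighted_graph "V N" "E N" "\<mu> N"
        using graphs by (intro weighted_graph.intro) auto
      show ?thesis using cover_time_tail_exponential by auto
    qed (auto intro: exI[of _ 1])
  qed
  from choice[OF this] obtain c\<^sub>2 where c2_all: "\<forall>N. 0 < c\<^sub>2 N \<and> (1 \<le> N \<and> 1 < card (V N) \<longrightarrow>
      (\<forall>z\<in>V N. \<forall>t. ?tail N z t \<le> c\<^sub>2 N * exp (- real t / c\<^sub>2 N)))"
    by (elim exE)
  then have c2: "0 < c\<^sub>2 N" for N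
    by blast
  define c\<^sub>0 where "c\<^sub>0 = 1 + c\<^sub>1 + (\<Sum>N<N\<^sub>0. c\<^sub>2 N)"
  have sum2: "0 \<le> (\<Sum>N<N\<^sub>0. c\<^sub>2 N)"
    using c2 by (intro sum_nonneg) (simp add: less_imp_le)
  have c0: "1 \<le> c\<^sub>0" "c\<^sub>1 \<le> c\<^sub>0"
    using c1(1) sum2 by (auto simp: c\<^sub>0_def)
  have c0': "c\<^sub>2 N \<le> c\<^sub>0" if "N < N\<^sub>0" for N
    using member_le_sum[of N "{..<N\<^sub>0}" c\<^sub>2] that c2 c1(1) by (force simp: c\<^sub>0_def less_imp_le)
  have bound: "?tail N z t \<le> c\<^sub>0 * exp (- real t / (c\<^sub>0 * ?D N powr d\<^sub>w))" if N: "1 \<le> N" and z: "z \<in> V N" for N z t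
  proof (cases "1 < card (V N)")
    case False
    \<comment> \<open>A single vertex: the diameter is 0, division by \<open>0 powr d\<^sub>w = 0\<close> yields 0, and the right-hand
      side is the constant itself.\<close>
    have "finite (V N)" using graphs[OF N] by (simp add: finite_weighted_graph_def)
    then have "card (V N) \<noteq> 0" using z by auto
    then have "card (V N) = 1"
      using False by linarith
    then have "?D N = 0" using gdiam_singleton by simp
    moreover have "?tail N z t \<le> 1"
      unfolding lazy_walk_law_def by (rule prob_space.prob_le_1[OF prob_space_chain_law])
    ultimately show ?thesis using c0 by simp
  next
    case True
    interpret weighted_graph "V N" "E N" "\<mu> N"
      using graphs[OF N] True by (rule weighted_graph.intro)
    have D: "1 \<le> ?D N powr d\<^sub>w"
      using gdiam_pos assms(2) by (intro ge_one_powr_ge_zero) auto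
    show ?thesis
    proof (cases "N\<^sub>0 \<le> N")
      case True
      have "?tail N z t \<le> c\<^sub>1 * exp (- real t / (c\<^sub>1 * ?D N powr d\<^sub>w))"
        using harnack[OF N \<open>1 < card (V N)\<close> large[OF True]] z by (rule c1(2))
      also have "\<dots> \<le> c\<^sub>0 * exp (- real t / (c\<^sub>0 * ?D N powr d\<^sub>w))"
        using c1(1) c0 D gdiam_pos by (intro exponential_tail_mono) auto
      finally show ?thesis .
    next
      case False
      have "?tail N z t \<le> c\<^sub>2 N * exp (- real t / (c\<^sub>2 N * 1))"
        using c2_all N \<open>1 < card (V N)\<close> z unfolding mult_1_right by blast
      also have "\<dots> \<le> c\<^sub>0 * exp (- real t / (c\<^sub>0 * ?D N powr d\<^sub>w))"
        using c2[of N] c0' False D by (intro exponential_tail_mono) auto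
      finally show ?thesis .
    qed
  qed
  show ?thesis
  proof (intro exI[of _ c\<^sub>0] conjI allI impI)
    show "0 < c\<^sub>0" using c0 by simp
    fix t N :: nat assume N: "1 \<le> N"
    have "V N \<noteq> {}" using graphs[OF N] by (simp add: finite_weighted_graph_def)
    then show "(SUP z\<in>V N. ?tail N z t) \<le> c\<^sub>0 * exp (- real t / (c\<^sub>0 * ?D N powr d\<^sub>w))"
      using bound[OF N] by (intro cSUP_least)
  qed
qed

end
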